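(* Let $(A,\mu_1,\mu_2,\alpha)$ be a compatible Hom-associative algebra and $(M,\ell_1,r_1,\ell_2,r_2,\beta)$ a compatible $A$-bimodule. Then there is a one-to-one correspondence $$H^{2,c}_{\alpha,\beta}(A,M)\cong\mathcal{E}xt_c(A,M)$$ between the second cohomology group of $A$ with coefficients in $M$ and the set of equivalence classes of abelian extensions of $A$ by $M$ for which the induced compatible $A$-bimodule structure on $M$ is the given one.
   Context: $\mathbb K$ is a field of characteristic $0$; all vector spaces are finite-dimensional over $\mathbb K$. A Hom-associative algebra $(A,\mu,\alpha)$: bilinear $\mu(a,b)=a\cdot b$ and linear $\alpha:A\to A$ with $\alpha(a\cdot b)=\alpha(a)\cdot\alpha(b)$ and $(a\cdot b)\cdot\alpha(c)=\alpha(a)\cdot(b\cdot c)$. A bimodule $(M,\ell,r,\beta)$ over it: bilinear $\ell(a,m)=a\lhd m$, $r(m,a)=m\rhd a$ and a linear map $\beta:M\to M$ (assumed invertible) with $\beta(a\lhd m)=\alpha(a)\lhd\beta(m)$, $\beta(m\rhd a)=\beta(m)\rhd\alpha(a)$, $(a\cdot b)\lhd\beta(m)=\alpha(a)\lhd(b\lhd m)$, $(a\lhd m)\rhd\alpha(b)=\alpha(a)\lhd(m\rhd b)$, $(m\rhd a)\rhd\alpha(b)=\beta(m)\rhd(a\cdot b)$. A compatible Hom-associative algebra $(A,\mu_1,\mu_2,\alpha)$: both $(A,\mu_k,\alpha)$ are Hom-associative and $(a\cdot_1 b)\cdot_2\alpha(c)+(a\cdot_2 b)\cdot_1\alpha(c)=\alpha(a)\cdot_1(b\cdot_2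 c)+\alpha(a)\cdot_2(b\cdot_1 c)$. Morphisms are linear maps that are Hom-associative algebra morphisms for both products (preserving both multiplications and commuting with the twisting maps). A compatible $A$-bimodule $(M,\ell_1,r_1,\ell_2,r_2,\beta)$: $(M,\ell_k,r_k,\beta)$ is a bimodule over $(A,\mu_k,\alpha)$ for $k=1,2$ and $(a\cdot_1b)\lhd_2\beta(m)+(a\cdot_2b)\lhd_1\beta(m)=\alpha(a)\lhd_1(b\lhd_2m)+\alpha(a)\lhd_2(b\lhd_1m)$, $(a\lhd_1m)\rhd_2\alpha(b)+(a\lhd_2m)\rhd_1\alpha(b)=\alpha(a)\lhd_1(m\rhd_2b)+\alpha(a)\lhd_2(m\rhd_1b)$, $(m\rhd_1a)\rhd_2\alpha(b)+(m\rhd_2a)\rhd_1\alpha(b)=\beta(m)\rhd_1(a\cdot_2b)+\beta(m)\rhd_2(a\cdot_1b)$. For $n\ge1$, $C^n_{\alpha,\beta}(A,M)=\{f:A^{\otimes n}\to M\text{ linear}\mid\beta\circ f=f\circ\alpha^{\otimes n}\}$, and for $k=1,2$ $$({}^k\delta_{\alpha,\beta}f)(a_1,\dots,a_{n+1})=\alpha^{n-1}(a_1)\lhd_kf(a_2,\dots,a_{n+1})+\sum_{i=1}^n(-1)^if(\alpha(a_1),\dots,\alpha(a_{i-1}),a_i\cdot_ka_{i+1},\alpha(a_{i+2}),\dots,\alpha(a_{n+1}))+(-1)^{n+1}f(a_1,\dots,a_n)\rhd_k\alpha^{n-1}(a_{n+1}).$$ $C^{n,c}_{\alpha,\beta}(A,M)$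 is the direct sum of $n$ copies of $C^n_{\alpha,\beta}(A,M)$, with differential $\delta^{n,c}_{\alpha,\beta}(f_1,\dots,f_n)=({}^1\delta f_1,\,{}^2\delta f_1+{}^1\delta f_2,\dots,{}^2\delta f_{n-1}+{}^1\delta f_n,\,{}^2\delta f_n)$ (where ${}^k\delta={}^k\delta_{\alpha,\beta}$). $H^{2,c}_{\alpha,\beta}(A,M)=\ker\delta^{2,c}_{\alpha,\beta}/\mathrm{im}\,\delta^{1,c}_{\alpha,\beta}$. An abelian extension of $A$ by $(M,\beta)$ is an exact sequence of compatible Hom-associative algebras $0\to(M,0,0,\beta)\xrightarrow{i}(E,\mu^E_1,\mu^E_2,\alpha^E)\xrightarrow{j}(A,\mu_1,\mu_2,\alpha)\to0$ together with a $\mathbb K$-linear splitting $s:A\to E$ of $j$ satisfying $\alpha^E\circ s=s\circ\alpha$. It induces a compatible $A$-bimodule structure on $(M,\beta)$ (independent of $s$) by $\ell_k(a,m)=\mu^E_k(s(a),i(m))$, $r_k(m,a)=\mu^E_k(i(m),s(a))$, $k=1,2$ (identifying $M$ with $i(M)$). Two abelian extensions $(E,i,j)$, $(E',i',j')$ are equivalent if there is a morphism of compatible Hom-associative algebras $\phi:E\to E'$ with $\phi\circ i=i'$ and $j'\circ\phi=j$ (no compatibility with the splittings is required). *)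

theory Defs
  imports
    "HOL-Algebra.Coset"
    "Jordan_Normal_Form.Missing_VectorSpace"
begin

text \<open>
  Vector spaces are carrier-based (\<^locale>\<open>vectorspace\<close>), so that the total spaces of extensions
  range over all vector spaces whose elements are taken from a given type. The two products and
  the two pairs of actions are indexed by \<open>k \<in> {1, 2}\<close>; other values of \<open>k\<close> are irrelevant, as is
  the value of any operation outside the carriers, and so are the ring multiplication and unit
  that \<^typ>\<open>('k, 'v) module\<close> inherits from the record of rings.
\<close>

definition bilinear_map ::
    "('k, 'x) ring_scheme \<Rightarrow> ('k, 'u, 'y) module_scheme \<Rightarrow> ('k, 'v, 'z) module_scheme
      \<Rightarrow> ('k, 'w, 't) module_scheme \<Rightarrow> ('u \<Rightarrow> 'v \<Rightarrow> 'w) \<Rightarrow> bool"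
  where "bilinear_map K U V W f \<longleftrightarrow>
    (\<forall>u\<in>carrier U. linear_map K V W (f u)) \<and>
    (\<forall>v\<in>carrier V. linear_map K U W (\<lambda>u. f u v))"

locale hom_assoc_algebra =
  vectorspace K A for K :: "('k, 'x) ring_scheme" and A :: "('k, 'a, 'y) module_scheme" +
  fixes mu :: "'a \<Rightarrow> 'a \<Rightarrow> 'a" and al :: "'a \<Rightarrow> 'a"
  assumes fin_dim: "fin_dim"
    and bilinear: "bilinear_map K A A A mu"
    and linear: "linear_map K A A al"
    and multiplicative: "\<lbrakk>a \<in> carrier A; b \<in> carrier A\<rbrakk> \<Longrightarrow> al (mu a b) = mu (al a) (al b)"
    and hom_assoc: "\<lbrakk>a \<in> carrier A; b \<in> carrier A; c \<in> carrier A\<rbrakk>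
        \<Longrightarrow> mu (mu a b) (al c) = mu (al a) (mu b c)"

locale hom_assoc_bimodule =
  A: hom_assoc_algebra K A mu al + M: vectorspace K M
  for K :: "('k, 'x) ring_scheme" and A :: "('k, 'a, 'y) module_scheme"
    and mu :: "'a \<Rightarrow> 'a \<Rightarrow> 'a" and al :: "'a \<Rightarrow> 'a" and M :: "('k, 'm, 'z) module_scheme" +
  fixes l :: "'a \<Rightarrow> 'm \<Rightarrow> 'm" and r :: "'m \<Rightarrow> 'a \<Rightarrow> 'm" and be :: "'m \<Rightarrow> 'm"
  assumes M_fin_dim: "M.fin_dim"
    and l_bilinear: "bilinear_map K A M M l"
    and r_bilinear: "bilinear_map K M A M r"
    and be_linear: "linear_map K M M be"
    and be_invertible: "bij_betw be (carrier M) (carrier M)"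
    and be_l: "\<lbrakk>a \<in> carrier A; m \<in> carrier M\<rbrakk> \<Longrightarrow> be (l a m) = l (al a) (be m)"
    and be_r: "\<lbrakk>m \<in> carrier M; a \<in> carrier A\<rbrakk> \<Longrightarrow> be (r m a) = r (be m) (al a)"
    and l_assoc: "\<lbrakk>a \<in> carrier A; b \<in> carrier A; m \<in> carrier M\<rbrakk>
        \<Longrightarrow> l (mu a b) (be m) = l (al a) (l b m)"
    and l_r_assoc: "\<lbrakk>a \<in> carrier A; m \<in> carrier M; b \<in> carrier A\<rbrakk>
        \<Longrightarrow> r (l a m) (al b) = l (al a) (r m b)"
    and r_assoc: "\<lbrakk>m \<in> carrier M; a \<in> carrier A; b \<in> carrier A\<rbrakk>
        \<Longrightarrow> r (r m a) (al b) = r (be m) (mu a b)"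

record ('k, 'a) comp_alg = "('k, 'a) module" +
  prd :: "nat \<Rightarrow> 'a \<Rightarrow> 'a \<Rightarrow> 'a"
  twist :: "'a \<Rightarrow> 'a"

record ('k, 'a, 'm) comp_bimod = "('k, 'm) module" +
  lact :: "nat \<Rightarrow> 'a \<Rightarrow> 'm \<Rightarrow> 'm"
  ract :: "nat \<Rightarrow> 'm \<Rightarrow> 'a \<Rightarrow> 'm"
  btwist :: "'m \<Rightarrow> 'm"

locale compatible_hom_assoc_algebra =
  fixes K :: "('k, 'x) ring_scheme" and A :: "('k, 'a) comp_alg" (structure)
  assumes hom_assoc_algebra: "k \<in> {1, 2} \<Longrightarrow> hom_assoc_algebra K A (prd A k) (twist A)"
    and compatible: "\<lbrakk>a \<in> carrier A; b \<in> carrier A; c \<in> carrier A\<rbrakk> \<Longrightarrow>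
      prd A 2 (prd A 1 a b) (twist A c) \<oplus> prd A 1 (prd A 2 a b) (twist A c)
      = prd A 1 (twist A a) (prd A 2 b c) \<oplus> prd A 2 (twist A a) (prd A 1 b c)"

locale compatible_bimodule =
  A: compatible_hom_assoc_algebra K A
  for K :: "('k, 'x) ring_scheme" and A :: "('k, 'a) comp_alg" +
  fixes M :: "('k, 'a, 'm) comp_bimod" (structure)
  assumes bimodule: "k \<in> {1, 2} \<Longrightarrow>
      hom_assoc_bimodule K A (prd A k) (twist A) M (lact M k) (ract M k) (btwist M)"
    and compatible_l: "\<lbrakk>a \<in> carrier A; b \<in> carrier A; m \<in> carrier M\<rbrakk> \<Longrightarrow>
      lact M 2 (prd A 1 a b) (btwist M m) \<oplus> lact M 1 (prd A 2 a b) (btwist M m)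
      = lact M 1 (twist A a) (lact M 2 b m) \<oplus> lact M 2 (twist A a) (lact M 1 b m)"
    and compatible_l_r: "\<lbrakk>a \<in> carrier A; m \<in> carrier M; b \<in> carrier A\<rbrakk> \<Longrightarrow>
      ract M 2 (lact M 1 a m) (twist A b) \<oplus> ract M 1 (lact M 2 a m) (twist A b)
      = lact M 1 (twist A a) (ract M 2 m b) \<oplus> lact M 2 (twist A a) (ract M 1 m b)"
    and compatible_r: "\<lbrakk>m \<in> carrier M; a \<in> carrier A; b \<in> carrier A\<rbrakk> \<Longrightarrow>
      ract M 2 (ract M 1 m a) (twist A b) \<oplus> ract M 1 (ract M 2 m a) (twist A b)
      = ract M 1 (btwist M m) (prd A 2 a b) \<oplus> ract M 2 (btwist M m) (prd A 1 a b)"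

definition comp_alg_morphism ::
    "('k, 'x) ring_scheme \<Rightarrow> ('k, 'a) comp_alg \<Rightarrow> ('k, 'b) comp_alg \<Rightarrow> ('a \<Rightarrow> 'b) \<Rightarrow> bool"
  where "comp_alg_morphism K A B f \<longleftrightarrow>
    linear_map K A B f \<and>
    (\<forall>k\<in>{1, 2}. \<forall>a\<in>carrier A. \<forall>b\<in>carrier A. f (prd A k a b) = prd B k (f a) (f b)) \<and>
    (\<forall>a\<in>carrier A. f (twist A a) = twist B (f a))"

text \<open>
  A linear map on \<open>A\<^sup>\<otimes>\<^sup>n\<close> is represented by the corresponding multilinear map on lists of length
  \<open>n\<close> over the carrier; it is \<^const>\<open>undefined\<close> elsewhere, so that equal cochains are equal functions.
\<close>

definition tuples :: "('a, 'y) partial_object_scheme \<Rightarrow> nat \<Rightarrow> 'a list set"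
  where "tuples A n = {as \<in> lists (carrier A). length as = n}"

definition cochains ::
    "('k, 'x) ring_scheme \<Rightarrow> ('k, 'a) comp_alg \<Rightarrow> ('k, 'a, 'm) comp_bimod \<Rightarrow> nat
      \<Rightarrow> ('a list \<Rightarrow> 'm) set"
  where "cochains K A M n = {f \<in> tuples A n \<rightarrow>\<^sub>E carrier M.
    (\<forall>as\<in>tuples A n. \<forall>i<n. linear_map K A M (\<lambda>a. f (as[i := a]))) \<and>
    (\<forall>as\<in>tuples A n. btwist M (f as) = f (map (twist A) as))}"

text \<open>List positions start at 0: the argument written \<open>a\<^sub>i\<close> on paper is \<open>as ! (i - 1)\<close>.\<close>

definition hochschild_diff ::
    "('k, 'x) ring_scheme \<Rightarrow> ('k, 'a) comp_alg \<Rightarrow> ('k, 'a, 'm) comp_bimod \<Rightarrow> nat \<Rightarrow> nat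
      \<Rightarrow> ('a list \<Rightarrow> 'm) \<Rightarrow> 'a list \<Rightarrow> 'm"
  where "hochschild_diff K A M k n f = (\<lambda>as\<in>tuples A (n + 1).
    lact M k ((twist A ^^ (n - 1)) (as ! 0)) (f (tl as))
    \<oplus>\<^bsub>M\<^esub> (\<Oplus>\<^bsub>M\<^esub>i\<in>{1..n}. ((\<ominus>\<^bsub>K\<^esub> \<one>\<^bsub>K\<^esub>) [^]\<^bsub>K\<^esub> i) \<odot>\<^bsub>M\<^esub>
        f (map (twist A) (take (i - 1) as)
           @ [prd A k (as ! (i - 1)) (as ! i)]
           @ map (twist A) (drop (i + 1) as)))
    \<oplus>\<^bsub>M\<^esub> ((\<ominus>\<^bsub>K\<^esub> \<one>\<^bsub>K\<^esub>) [^]\<^bsub>K\<^esub> (n + 1)) \<odot>\<^bsub>M\<^esub>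
        ract M k (f (butlast as)) ((twist A ^^ (n - 1)) (as ! n)))"

text \<open>The direct sum of \<open>n\<close> copies of the cochains: families indexed by \<open>{1..n}\<close>, under addition.\<close>

definition comp_cochain_group ::
    "('k, 'x) ring_scheme \<Rightarrow> ('k, 'a) comp_alg \<Rightarrow> ('k, 'a, 'm) comp_bimod \<Rightarrow> nat
      \<Rightarrow> (nat \<Rightarrow> 'a list \<Rightarrow> 'm) monoid"
  where "comp_cochain_group K A M n =
    \<lparr>carrier = {1..n} \<rightarrow>\<^sub>E cochains K A M n,
     monoid.mult = (\<lambda>F G. \<lambda>i\<in>{1..n}. \<lambda>as\<in>tuples A n. F i as \<oplus>\<^bsub>M\<^esub> G i as),
     monoid.one = (\<lambda>i\<in>{1..n}. \<lambda>as\<in>tuples A n. \<zero>\<^bsub>M\<^esub>)\<rparr>"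

definition comp_diff ::
    "('k, 'x) ring_scheme \<Rightarrow> ('k, 'a) comp_alg \<Rightarrow> ('k, 'a, 'm) comp_bimod \<Rightarrow> nat
      \<Rightarrow> (nat \<Rightarrow> 'a list \<Rightarrow> 'm) \<Rightarrow> nat \<Rightarrow> 'a list \<Rightarrow> 'm"
  where "comp_diff K A M n F = (\<lambda>i\<in>{1..n + 1}. \<lambda>as\<in>tuples A (n + 1).
    if i = 1 then hochschild_diff K A M 1 n (F 1) as
    else if i = n + 1 then hochschild_diff K A M 2 n (F n) as
    else hochschild_diff K A M 2 n (F (i - 1)) as \<oplus>\<^bsub>M\<^esub> hochschild_diff K A M 1 n (F i) as)"

text \<open>Kernel modulo image, meaningful for \<open>n \<ge> 2\<close> since the complex starts in degree 1.\<close>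

definition comp_cohomology ::
    "('k, 'x) ring_scheme \<Rightarrow> ('k, 'a) comp_alg \<Rightarrow> ('k, 'a, 'm) comp_bimod \<Rightarrow> nat
      \<Rightarrow> (nat \<Rightarrow> 'a list \<Rightarrow> 'm) set monoid"
  where "comp_cohomology K A M n =
    (comp_cochain_group K A M n)
      \<lparr>carrier := kernel (comp_cochain_group K A M n) (comp_cochain_group K A M (n + 1))
                    (comp_diff K A M n)\<rparr>
    Mod (comp_diff K A M (n - 1) ` carrier (comp_cochain_group K A M (n - 1)))"

definition trivial_comp_alg :: "('k, 'a, 'm) comp_bimod \<Rightarrow> ('k, 'm) comp_alg"
  where "trivial_comp_alg M =
    \<lparr>carrier = carrier M, monoid.mult = monoid.mult M, monoid.one = monoid.one M, zero = zero M, add = add M, smult = smult M,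
     prd = (\<lambda>k m m'. \<zero>\<^bsub>M\<^esub>), twist = btwist M\<rparr>"

record ('k, 'a, 'm, 'e) extension =
  total :: "('k, 'e) comp_alg"
  incl :: "'m \<Rightarrow> 'e"
  proj :: "'e \<Rightarrow> 'a"
  sect :: "'a \<Rightarrow> 'e"

locale abelian_extension =
  fixes K :: "('k, 'x) ring_scheme" and A :: "('k, 'a) comp_alg"
    and M :: "('k, 'a, 'm) comp_bimod" and X :: "('k, 'a, 'm, 'e) extension"
  assumes total_algebra: "compatible_hom_assoc_algebra K (total X)"
    and incl_morphism: "comp_alg_morphism K (trivial_comp_alg M) (total X) (incl X)"
    and proj_morphism: "comp_alg_morphism K (total X) A (proj X)"
    and incl_inj: "inj_on (incl X) (carrier M)"
    and exact: "incl X ` carrier M = {e \<in> carrier (total X). proj X e = \<zero>\<^bsub>A\<^esub>}"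
    and proj_surj: "proj X ` carrier (total X) = carrier A"
    and sect_linear: "linear_map K A (total X) (sect X)"
    and sect_splits: "a \<in> carrier A \<Longrightarrow> proj X (sect X a) = a"
    and sect_twist: "a \<in> carrier A \<Longrightarrow> twist (total X) (sect X a) = sect X (twist A a)"

definition induced_lact :: "('k, 'a, 'm) comp_bimod \<Rightarrow> ('k, 'a, 'm, 'e) extension
    \<Rightarrow> nat \<Rightarrow> 'a \<Rightarrow> 'm \<Rightarrow> 'm"
  where "induced_lact M X k a m =
    inv_into (carrier M) (incl X) (prd (total X) k (sect X a) (incl X m))"

definition induced_ract :: "('k, 'a, 'm) comp_bimod \<Rightarrow> ('k, 'a, 'm, 'e) extension
    \<Rightarrow> nat \<Rightarrow> 'm \<Rightarrow> 'a \<Rightarrow> 'm"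
  where "induced_ract M X k m a =
    inv_into (carrier M) (incl X) (prd (total X) k (incl X m) (sect X a))"

definition extensions_inducing ::
    "('k, 'x) ring_scheme \<Rightarrow> ('k, 'a) comp_alg \<Rightarrow> ('k, 'a, 'm) comp_bimod
      \<Rightarrow> ('k, 'a, 'm, 'e) extension set"
  where "extensions_inducing K A M = {X. abelian_extension K A M X \<and>
    (\<forall>k\<in>{1, 2}. \<forall>a\<in>carrier A. \<forall>m\<in>carrier M.
       induced_lact M X k a m = lact M k a m \<and> induced_ract M X k m a = ract M k m a)}"

definition extension_equiv ::
    "('k, 'x) ring_scheme \<Rightarrow> ('k, 'a) comp_alg \<Rightarrow> ('k, 'a, 'm) comp_bimod
      \<Rightarrow> ('k, 'a, 'm, 'e) extension rel"
  where "extension_equiv K A M =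
    {(X, Y). X \<in> extensions_inducing K A M \<and> Y \<in> extensions_inducing K A M \<and>
      (\<exists>\<phi>. comp_alg_morphism K (total X) (total Y) \<phi> \<and>
           (\<forall>m\<in>carrier M. \<phi> (incl X m) = incl Y m) \<and>
           (\<forall>e\<in>carrier (total X). proj Y (\<phi> e) = proj X e))}"

definition Ext_c ::
    "('k, 'x) ring_scheme \<Rightarrow> ('k, 'a) comp_alg \<Rightarrow> ('k, 'a, 'm) comp_bimod
      \<Rightarrow> ('k, 'a, 'm, 'e) extension set set"
  where "Ext_c K A M = extensions_inducing K A M // extension_equiv K A M"

end

theory Submission
  imports Defs
begin

text \<open>
  This is the classical description of extensions by factor sets. The given splitting \<open>s\<close> of
  an abelian extension \<open>0 \<rightarrow> M \<rightarrow> E \<rightarrow> A \<rightarrow> 0\<close> identifies \<open>E\<close> with \<open>A \<times> M\<close>, an element \<open>e\<close> having the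
  coordinates \<open>j e\<close> and \<open>i\<^sup>-\<^sup>1 (e - s (j e))\<close>. Since \<open>M\<close> has zero products and the extension induces
  the given actions, the products of \<open>E\<close> read in these coordinates
  \<open>(a, m) \<cdot>\<^sub>k (b, n) = (a \<cdot>\<^sub>k b, F\<^sub>k(a, b) + a \<lhd>\<^sub>k n + m \<rhd>\<^sub>k b)\<close>, and the only freedom left is the pair
  \<open>F = (F\<^sub>1, F\<^sub>2)\<close> of bilinear maps, the factor set of the extension. Compatibility of \<open>s\<close> with
  the twisting maps makes \<open>F\<close> a cochain.

  Three facts yield the bijection.

  \<^item> Comparing the two bracketings of a product of three lifts \<open>s a, s b, s c\<close> shows that
    Hom-associativity of the two products and their compatibility are exactly the three
    components of \<open>\<delta>F = 0\<close> (lemmas \<open>kernel_comp_diff_2\<close> and \<open>factor_set_cocycle\<close>).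

  \<^item> A morphism of extensions is forced to be \<open>(a, m) \<mapsto> (a, g a + m)\<close> with \<open>g : A \<rightarrow> M\<close> linear and
    commuting with the twisting maps, and it respects the products if and only if the two
    factor sets differ by \<open>\<delta>g\<close>. Hence equivalence of extensions is equality of the cohomology
    classes of their factor sets (lemma \<open>extension_equiv_iff\<close>). In particular it is an
    equivalence relation.

  \<^item> Every cocycle \<open>F\<close> is the factor set of some extension: the displayed formula defines one on
    \<open>A \<times> M\<close>, transported along the embedding into the type of elements
    (locale \<open>twisted_product\<close>).

  So sending an extension to the class of its factor set has image the second cohomology group
  and its fibres are the equivalence classes of extensions.
\<close>

(* Keeps the product index and the degree 1 in the form in which they occur in the definitions. *)
declare One_nat_def [simp del]

section \<open>Linear and bilinear maps\<close>

lemma linear_map_iff: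
  assumes "vectorspace K V" "vectorspace K W"
  shows "linear_map K V W T \<longleftrightarrow>
    (\<forall>v\<in>carrier V. T v \<in> carrier W) \<and>
    (\<forall>u\<in>carrier V. \<forall>v\<in>carrier V. T (u \<oplus>\<^bsub>V\<^esub> v) = T u \<oplus>\<^bsub>W\<^esub> T v) \<and>
    (\<forall>c\<in>carrier K. \<forall>v\<in>carrier V. T (c \<odot>\<^bsub>V\<^esub> v) = c \<odot>\<^bsub>W\<^esub> T v)"
  using assms
  by (auto simp: linear_map_def mod_hom_def mod_hom_axioms_def module_hom_def vectorspace_def)

lemma bilinear_map_iff:
  assumes "vectorspace K U" "vectorspace K V" "vectorspace K W"
  shows "bilinear_map K U V W f \<longleftrightarrow>
    (\<forall>u\<in>carrier U. \<forall>v\<in>carrier V. f u v \<in> carrier W) \<and>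
    (\<forall>u\<in>carrier U. \<forall>v\<in>carrier V. \<forall>v'\<in>carrier V.
       f u (v \<oplus>\<^bsub>V\<^esub> v') = f u v \<oplus>\<^bsub>W\<^esub> f u v') \<and>
    (\<forall>c\<in>carrier K. \<forall>u\<in>carrier U. \<forall>v\<in>carrier V. f u (c \<odot>\<^bsub>V\<^esub> v) = c \<odot>\<^bsub>W\<^esub> f u v) \<and>
    (\<forall>u\<in>carrier U. \<forall>u'\<in>carrier U. \<forall>v\<in>carrier V.
       f (u \<oplus>\<^bsub>U\<^esub> u') v = f u v \<oplus>\<^bsub>W\<^esub> f u' v) \<and>
    (\<forall>c\<in>carrier K. \<forall>u\<in>carrier U. \<forall>v\<in>carrier V. f (c \<odot>\<^bsub>U\<^esub> u) v = c \<odot>\<^bsub>W\<^esub> f u v)"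
  unfolding bilinear_map_def linear_map_iff[OF assms(2,3)] linear_map_iff[OF assms(1,3)]
  by blast

lemma (in module) additive_zero:
  assumes "abelian_group N" "\<And>x. x \<in> carrier M \<Longrightarrow> f x \<in> carrier N"
    "\<And>x y. x \<in> carrier M \<Longrightarrow> y \<in> carrier M \<Longrightarrow> f (x \<oplus>\<^bsub>M\<^esub> y) = f x \<oplus>\<^bsub>N\<^esub> f y"
  shows "f \<zero>\<^bsub>M\<^esub> = \<zero>\<^bsub>N\<^esub>"
proof -
  interpret N: abelian_group N by fact
  have "f \<zero>\<^bsub>M\<^esub> \<oplus>\<^bsub>N\<^esub> f \<zero>\<^bsub>M\<^esub> = f \<zero>\<^bsub>M\<^esub>"
    using assms(3)[of "\<zero>\<^bsub>M\<^esub>" "\<zero>\<^bsub>M\<^esub>"] by simp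
  then show ?thesis
    using assms(2)[of "\<zero>\<^bsub>M\<^esub>"] by simp
qed

text \<open>
  The single negative term of a coboundary moves to the other side.
\<close>

lemma (in abelian_group) eq_alternating_sum_iff:
  assumes "x \<in> carrier G" "u \<in> carrier G" "v \<in> carrier G" "w \<in> carrier G" "y \<in> carrier G"
  shows "x = (u \<oplus> \<ominus> w \<oplus> v) \<oplus> y \<longleftrightarrow> x \<oplus> w = u \<oplus> v \<oplus> y"
proof -
  have "(u \<oplus> \<ominus> w \<oplus> v) \<oplus> y = (u \<oplus> v \<oplus> y) \<oplus> \<ominus> w"
    using assms by (simp add: a_ac)
  then show ?thesis
    using assms by (metis a_closed add.inv_solve_right')
qed

lemma (in abelian_group) sum_regroup:
  assumes "u \<in> carrier G" "x \<in> carrier G" "y \<in> carrier G" "z \<in> carrier G"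
    "u' \<in> carrier G" "x' \<in> carrier G" "y' \<in> carrier G" "z' \<in> carrier G"
  shows "(u \<oplus> (x \<oplus> (y \<oplus> z))) \<oplus> (u' \<oplus> (x' \<oplus> (y' \<oplus> z')))
    = (u \<oplus> u') \<oplus> ((x \<oplus> x') \<oplus> ((y \<oplus> y') \<oplus> (z \<oplus> z')))"
  using assms by (simp add: a_ac)

context compatible_hom_assoc_algebra
begin

sublocale V: vectorspace K A
  using hom_assoc_algebra[of 1] by (simp add: hom_assoc_algebra_def)

lemma fin_dim: "V.fin_dim"
  using hom_assoc_algebra[of 1] by (simp add: hom_assoc_algebra_def hom_assoc_algebra_axioms_def)

lemma
  assumes "k \<in> {1, 2}"
  shows prd_bilinear: "bilinear_map K A A A (prd A k)"
    and twist_prd: "\<lbrakk>a \<in> carrier A; b \<in> carrier A\<rbrakk>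
      \<Longrightarrow> twist A (prd A k a b) = prd A k (twist A a) (twist A b)"
    and prd_assoc: "\<lbrakk>a \<in> carrier A; b \<in> carrier A; c \<in> carrier A\<rbrakk>
      \<Longrightarrow> prd A k (prd A k a b) (twist A c) = prd A k (twist A a) (prd A k b c)"
  using hom_assoc_algebra[OF assms]
  by (simp_all add: hom_assoc_algebra_def hom_assoc_algebra_axioms_def)

lemma twist_linear: "linear_map K A A (twist A)"
  using hom_assoc_algebra[of 1] by (simp add: hom_assoc_algebra_def hom_assoc_algebra_axioms_def)

lemmas prd_bilinear_laws =
  prd_bilinear[unfolded bilinear_map_iff[OF V.vectorspace_axioms V.vectorspace_axioms V.vectorspace_axioms]]

lemma
  assumes "k \<in> {1, 2}" "a \<in> carrier A" "b \<in> carrier A"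
  shows prd_closed [simp]: "prd A k a b \<in> carrier A"
    and prd_add_right: "c \<in> carrier A \<Longrightarrow> prd A k a (b \<oplus> c) = prd A k a b \<oplus> prd A k a c"
    and prd_smult_right: "c' \<in> carrier K \<Longrightarrow> prd A k a (c' \<odot> b) = c' \<odot> prd A k a b"
    and prd_add_left: "c \<in> carrier A \<Longrightarrow> prd A k (a \<oplus> b) c = prd A k a c \<oplus> prd A k b c"
    and prd_smult_left: "c' \<in> carrier K \<Longrightarrow> prd A k (c' \<odot> a) b = c' \<odot> prd A k a b"
  using prd_bilinear_laws[OF assms(1)] assms(2,3) by blast+

lemma
  assumes "k \<in> {1, 2}" "a \<in> carrier A"
  shows prd_zero_right [simp]: "prd A k a \<zero> = \<zero>" and prd_zero_left [simp]: "prd A k \<zero> a = \<zero>"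
  using assms prd_add_right prd_add_left
  by (intro V.additive_zero[of A "prd A k a"] V.additive_zero[of A "\<lambda>x. prd A k x a"];
      simp add: V.M.abelian_group_axioms)+

lemma
  assumes "a \<in> carrier A"
  shows twist_closed [simp]: "twist A a \<in> carrier A"
    and twist_add: "b \<in> carrier A \<Longrightarrow> twist A (a \<oplus> b) = twist A a \<oplus> twist A b"
    and twist_smult: "c \<in> carrier K \<Longrightarrow> twist A (c \<odot> a) = c \<odot> twist A a"
  using twist_linear assms
  unfolding linear_map_iff[OF V.vectorspace_axioms V.vectorspace_axioms] by blast+

lemma twist_zero [simp]: "twist A \<zero> = \<zero>"
  by (intro V.additive_zero) (simp_all add: V.M.abelian_group_axioms twist_add)

end

context compatible_bimodule
begin

sublocale M: vectorspace K M
  using bimodule[of 1] by (simp add: hom_assoc_bimodule_def)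

lemma fin_dim: "M.fin_dim"
  using bimodule[of 1] by (simp add: hom_assoc_bimodule_def hom_assoc_bimodule_axioms_def)

lemma
  assumes "k \<in> {1, 2}"
  shows lact_bilinear: "bilinear_map K A M M (lact M k)"
    and ract_bilinear: "bilinear_map K M A M (ract M k)"
    and btwist_lact: "\<lbrakk>a \<in> carrier A; m \<in> carrier M\<rbrakk>
      \<Longrightarrow> btwist M (lact M k a m) = lact M k (twist A a) (btwist M m)"
    and btwist_ract: "\<lbrakk>m \<in> carrier M; a \<in> carrier A\<rbrakk>
      \<Longrightarrow> btwist M (ract M k m a) = ract M k (btwist M m) (twist A a)"
    and lact_assoc: "\<lbrakk>a \<in> carrier A; b \<in> carrier A; m \<in> carrier M\<rbrakk>
      \<Longrightarrow> lact M k (prd A k a b) (btwist M m) = lact M k (twist A a) (lact M k b m)"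
    and lact_ract_assoc: "\<lbrakk>a \<in> carrier A; m \<in> carrier M; b \<in> carrier A\<rbrakk>
      \<Longrightarrow> ract M k (lact M k a m) (twist A b) = lact M k (twist A a) (ract M k m b)"
    and ract_assoc: "\<lbrakk>m \<in> carrier M; a \<in> carrier A; b \<in> carrier A\<rbrakk>
      \<Longrightarrow> ract M k (ract M k m a) (twist A b) = ract M k (btwist M m) (prd A k a b)"
  using bimodule[OF assms]
  by (simp_all add: hom_assoc_bimodule_def hom_assoc_bimodule_axioms_def)

lemma btwist_linear: "linear_map K M M (btwist M)"
  using bimodule[of 1] by (simp add: hom_assoc_bimodule_def hom_assoc_bimodule_axioms_def)

lemmas lact_bilinear_laws =
  lact_bilinear[unfolded bilinear_map_iff[OF A.V.vectorspace_axioms M.vectorspace_axioms M.vectorspace_axioms]]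

lemmas ract_bilinear_laws =
  ract_bilinear[unfolded bilinear_map_iff[OF M.vectorspace_axioms A.V.vectorspace_axioms M.vectorspace_axioms]]

lemma
  assumes "k \<in> {1, 2}" "a \<in> carrier A" "m \<in> carrier M"
  shows lact_closed [simp]: "lact M k a m \<in> carrier M"
    and lact_add_right: "n \<in> carrier M \<Longrightarrow> lact M k a (m \<oplus> n) = lact M k a m \<oplus> lact M k a n"
    and lact_smult_right: "c \<in> carrier K \<Longrightarrow> lact M k a (c \<odot> m) = c \<odot> lact M k a m"
    and lact_add_left: "b \<in> carrier A \<Longrightarrow> lact M k (a \<oplus>\<^bsub>A\<^esub> b) m = lact M k a m \<oplus> lact M k b m"
    and lact_smult_left: "c \<in> carrier K \<Longrightarrow> lact M k (c \<odot>\<^bsub>A\<^esub> a) m = c \<odot> lact M k a m"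
  using lact_bilinear_laws[OF assms(1)] assms(2,3) by blast+

lemma
  assumes "k \<in> {1, 2}" "m \<in> carrier M" "a \<in> carrier A"
  shows ract_closed [simp]: "ract M k m a \<in> carrier M"
    and ract_add_right: "b \<in> carrier A \<Longrightarrow> ract M k m (a \<oplus>\<^bsub>A\<^esub> b) = ract M k m a \<oplus> ract M k m b"
    and ract_smult_right: "c \<in> carrier K \<Longrightarrow> ract M k m (c \<odot>\<^bsub>A\<^esub> a) = c \<odot> ract M k m a"
    and ract_add_left: "n \<in> carrier M \<Longrightarrow> ract M k (m \<oplus> n) a = ract M k m a \<oplus> ract M k n a"
    and ract_smult_left: "c \<in> carrier K \<Longrightarrow> ract M k (c \<odot> m) a = c \<odot> ract M k m a"
  using ract_bilinear_laws[OF assms(1)] assms(2,3) by blast+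

lemma
  assumes "k \<in> {1, 2}"
  shows lact_zero_right [simp]: "a \<in> carrier A \<Longrightarrow> lact M k a \<zero> = \<zero>"
    and lact_zero_left [simp]: "m \<in> carrier M \<Longrightarrow> lact M k \<zero>\<^bsub>A\<^esub> m = \<zero>"
    and ract_zero_right [simp]: "m \<in> carrier M \<Longrightarrow> ract M k m \<zero>\<^bsub>A\<^esub> = \<zero>"
    and ract_zero_left [simp]: "a \<in> carrier A \<Longrightarrow> ract M k \<zero> a = \<zero>"
  using assms lact_add_right lact_add_left ract_add_right ract_add_left
  by (intro M.additive_zero[of M "lact M k a"] A.V.additive_zero[of M "\<lambda>x. lact M k x m"]
        M.additive_zero[of M "\<lambda>x. ract M k x a"] A.V.additive_zero[of M "ract M k m"];
      simp add: M.M.abelian_group_axioms)+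

lemma
  assumes "m \<in> carrier M"
  shows btwist_closed [simp]: "btwist M m \<in> carrier M"
    and btwist_add: "n \<in> carrier M \<Longrightarrow> btwist M (m \<oplus> n) = btwist M m \<oplus> btwist M n"
    and btwist_smult: "c \<in> carrier K \<Longrightarrow> btwist M (c \<odot> m) = c \<odot> btwist M m"
  using btwist_linear assms
  unfolding linear_map_iff[OF M.vectorspace_axioms M.vectorspace_axioms] by blast+

lemma btwist_zero [simp]: "btwist M \<zero> = \<zero>"
  by (intro M.additive_zero) (simp_all add: M.M.abelian_group_axioms btwist_add)

end

section \<open>The groups of cochains\<close>

lemma tuples_iff: "as \<in> tuples A n \<longleftrightarrow> set as \<subseteq> carrier A \<and> length as = n"
  by (auto simp: tuples_def)

lemma tuples_update: "as \<in> tuples A n \<Longrightarrow> a \<in> carrier A \<Longrightarrow> as[i := a] \<in> tuples A n"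
  by (auto simp: tuples_iff dest: set_update_subset_insert[THEN subsetD])

lemma
  shows mem_tuples_1: "as \<in> tuples A 1 \<longleftrightarrow> (\<exists>a\<in>carrier A. as = [a])"
    and mem_tuples_2: "as \<in> tuples A 2 \<longleftrightarrow> (\<exists>a\<in>carrier A. \<exists>b\<in>carrier A. as = [a, b])"
    and mem_tuples_3: "as \<in> tuples A 3 \<longleftrightarrow>
      (\<exists>a\<in>carrier A. \<exists>b\<in>carrier A. \<exists>c\<in>carrier A. as = [a, b, c])"
  by (auto simp: tuples_iff length_Suc_conv eval_nat_numeral One_nat_def)

context compatible_bimodule
begin

abbreviation cochain_group :: "nat \<Rightarrow> (nat \<Rightarrow> 'a list \<Rightarrow> 'm) monoid"
  where "cochain_group \<equiv> comp_cochain_group K A M"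

lemma twist_tuples: "as \<in> tuples A n \<Longrightarrow> map (twist A) as \<in> tuples A n"
  by (auto simp: tuples_iff)

lemma cochains_iff: "f \<in> cochains K A M n \<longleftrightarrow>
    f \<in> extensional (tuples A n) \<and> (\<forall>as\<in>tuples A n. f as \<in> carrier M) \<and>
    (\<forall>as\<in>tuples A n. \<forall>i<n. \<forall>a\<in>carrier A. \<forall>b\<in>carrier A.
       f (as[i := a \<oplus>\<^bsub>A\<^esub> b]) = f (as[i := a]) \<oplus> f (as[i := b])) \<and>
    (\<forall>as\<in>tuples A n. \<forall>i<n. \<forall>c\<in>carrier K. \<forall>a\<in>carrier A.
       f (as[i := c \<odot>\<^bsub>A\<^esub> a]) = c \<odot> f (as[i := a])) \<and>
    (\<forall>as\<in>tuples A n. btwist M (f as) = f (map (twist A) as))"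
  unfolding cochains_def linear_map_iff[OF A.V.vectorspace_axioms M.vectorspace_axioms]
  by (auto simp: PiE_def Pi_def tuples_update)

text \<open>
  All conditions defining cochains are linear in the cochain, so cochains form a group under
  pointwise addition, and the elements of the cohomology group are cosets of a subgroup.
\<close>

lemma cochains_add:
  assumes "f \<in> cochains K A M n" "g \<in> cochains K A M n"
  shows "(\<lambda>as\<in>tuples A n. f as \<oplus> g as) \<in> cochains K A M n"
  using assms unfolding cochains_iff
  by (simp add: tuples_update twist_tuples M.smult_r_distr btwist_add M.M.a_ac)

lemma btwist_minus: "m \<in> carrier M \<Longrightarrow> btwist M (\<ominus> m) = \<ominus> btwist M m"
  using btwist_smult[of m "\<ominus>\<^bsub>K\<^esub> \<one>\<^bsub>K\<^esub>"] by (simp add: M.smult_minus_1)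

lemma cochains_minus:
  assumes "f \<in> cochains K A M n"
  shows "(\<lambda>as\<in>tuples A n. \<ominus> f as) \<in> cochains K A M n"
  using assms unfolding cochains_iff
  by (simp add: tuples_update twist_tuples M.smult_r_minus btwist_minus M.M.minus_add)

lemma cochains_zero: "(\<lambda>as\<in>tuples A n. \<zero>) \<in> cochains K A M n"
  unfolding cochains_iff by (simp add: tuples_update twist_tuples)

lemma cochain_closed: "as \<in> tuples A n \<Longrightarrow> f \<in> cochains K A M n \<Longrightarrow> f as \<in> carrier M"
  by (simp add: cochains_iff)

lemma carrier_cochain_group: "F \<in> carrier (cochain_group n) \<longleftrightarrow>
    F \<in> extensional {1..n} \<and> (\<forall>i\<in>{1..n}. F i \<in> cochains K A M n)"
  by (auto simp: comp_cochain_group_def PiE_def Pi_def)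

lemma cochain_group_eqI:
  assumes "F \<in> carrier (cochain_group n)" "G \<in> carrier (cochain_group n)"
    "\<And>i as. i \<in> {1..n} \<Longrightarrow> as \<in> tuples A n \<Longrightarrow> F i as = G i as"
  shows "F = G"
proof (rule extensionalityI)
  show "F \<in> extensional {1..n}" "G \<in> extensional {1..n}"
    using assms by (auto simp: carrier_cochain_group)
  show "F i = G i" if "i \<in> {1..n}" for i
    using assms that
    by (intro extensionalityI[of _ "tuples A n"]) (auto simp: carrier_cochain_group cochains_iff)
qed

lemma cochain_group_mult:
  assumes "i \<in> {1..n}" "as \<in> tuples A n"
  shows "(F \<otimes>\<^bsub>cochain_group n\<^esub> G) i as = F i as \<oplus> G i as"
    and "\<one>\<^bsub>cochain_group n\<^esub> i as = \<zero>"
  using assms by (auto simp: comp_cochain_group_def)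

lemma cochain_group_closed:
  shows "F \<in> carrier (cochain_group n) \<Longrightarrow> G \<in> carrier (cochain_group n)
      \<Longrightarrow> F \<otimes>\<^bsub>cochain_group n\<^esub> G \<in> carrier (cochain_group n)"
    and "\<one>\<^bsub>cochain_group n\<^esub> \<in> carrier (cochain_group n)"
  by (simp_all add: carrier_cochain_group) (simp_all add: comp_cochain_group_def cochains_add cochains_zero)

lemma comm_group_cochain_group: "comm_group (cochain_group n)"
proof (rule comm_groupI, goal_cases)
  case (3 F G H)
  then show ?case
    by (intro cochain_group_eqI[of _ n] cochain_group_closed)
      (auto simp: cochain_group_mult carrier_cochain_group cochain_closed M.M.a_assoc)
next
  case (4 F G)
  then show ?case
    by (intro cochain_group_eqI[of _ n] cochain_group_closed)
      (auto simp: cochain_group_mult carrier_cochain_group cochain_closed M.M.a_comm)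
next
  case (5 F)
  then show ?case
    by (intro cochain_group_eqI[of _ n] cochain_group_closed)
      (auto simp: cochain_group_mult carrier_cochain_group cochain_closed)
next
  case (6 F)
  let ?G = "\<lambda>i\<in>{1..n}. \<lambda>as\<in>tuples A n. \<ominus> F i as"
  have G: "?G \<in> carrier (cochain_group n)"
    using 6 by (simp add: carrier_cochain_group cochains_minus)
  moreover have "?G \<otimes>\<^bsub>cochain_group n\<^esub> F = \<one>\<^bsub>cochain_group n\<^esub>"
    using 6 G by (intro cochain_group_eqI[of _ n] cochain_group_closed)
      (auto simp: cochain_group_mult carrier_cochain_group cochain_closed M.M.l_neg)
  ultimately show ?case by blast
qed (auto intro: cochain_group_closed)

lemma carrier_cochain_group_1: "F \<in> carrier (cochain_group 1) \<longleftrightarrow>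
    F \<in> extensional {1..1} \<and> F 1 \<in> cochains K A M 1"
  by (auto simp: carrier_cochain_group)

lemma atLeastAtMost_1_2: "{1..2::nat} = {1, 2}"
  by auto

lemma carrier_cochain_group_2: "F \<in> carrier (cochain_group 2) \<longleftrightarrow>
    F \<in> extensional {1..2} \<and> (\<forall>k\<in>{1, 2}. F k \<in> cochains K A M 2)"
  unfolding carrier_cochain_group atLeastAtMost_1_2 ..

lemma cochains_1_iff: "f \<in> cochains K A M 1 \<longleftrightarrow>
    f \<in> extensional (tuples A 1) \<and> linear_map K A M (\<lambda>a. f [a]) \<and>
    (\<forall>a\<in>carrier A. btwist M (f [a]) = f [twist A a])"
  unfolding cochains_iff linear_map_iff[OF A.V.vectorspace_axioms M.vectorspace_axioms]
  by (auto simp: Ball_def mem_tuples_1)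

lemma ball_tuples_2:
  "(\<forall>as\<in>tuples A 2. P as) \<longleftrightarrow> (\<forall>a\<in>carrier A. \<forall>b\<in>carrier A. P [a, b])"
  by (auto simp: mem_tuples_2)

lemma all_less_2: "(\<forall>i<2::nat. P i) \<longleftrightarrow> P 0 \<and> P 1"
  by (auto simp: less_2_cases_iff One_nat_def)

lemma cochains_2_iff: "f \<in> cochains K A M 2 \<longleftrightarrow>
    f \<in> extensional (tuples A 2) \<and> bilinear_map K A A M (\<lambda>a b. f [a, b]) \<and>
    (\<forall>a\<in>carrier A. \<forall>b\<in>carrier A. btwist M (f [a, b]) = f [twist A a, twist A b])"
  unfolding cochains_iff bilinear_map_iff[OF A.V.vectorspace_axioms A.V.vectorspace_axioms M.vectorspace_axioms]
  by (simp add: ball_tuples_2 all_less_2 One_nat_def) (auto; blast)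

lemma hochschild_diff_1:
  assumes "k \<in> {1, 2}" "f \<in> cochains K A M 1" "a \<in> carrier A" "b \<in> carrier A"
  shows "hochschild_diff K A M k 1 f [a, b] =
    lact M k a (f [b]) \<oplus> \<ominus> f [prd A k a b] \<oplus> ract M k (f [a]) b"
proof -
  have f: "f [x] \<in> carrier M" if "x \<in> carrier A" for x
    using that assms(2) by (auto intro!: cochain_closed[of _ 1] simp: mem_tuples_1)
  have "[a, b] \<in> tuples A 2" using assms by (auto simp: mem_tuples_2)
  then show ?thesis
    using assms f by (simp add: hochschild_diff_def M.smult_minus_1 M.smult_assoc1 numeral_2_eq_2 One_nat_def)
qed

text \<open>
  The terms are grouped by sign, so that the vanishing of the differential becomes an equation
  between sums without signs.
\<close>

lemma hochschild_diff_2: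
  assumes "k \<in> {1, 2}" "f \<in> cochains K A M 2" "a \<in> carrier A" "b \<in> carrier A" "c \<in> carrier A"
  shows "hochschild_diff K A M k 2 f [a, b, c] =
    (lact M k (twist A a) (f [b, c]) \<oplus> f [twist A a, prd A k b c])
    \<ominus> (f [prd A k a b, twist A c] \<oplus> ract M k (f [a, b]) (twist A c))"
proof -
  have f: "f [x, y] \<in> carrier M" if "x \<in> carrier A" "y \<in> carrier A" for x y
    using that assms(2) by (auto intro!: cochain_closed[of _ 2] simp: mem_tuples_2)
  have "[a, b, c] \<in> tuples A 3" using assms by (auto simp: mem_tuples_3)
  then have "hochschild_diff K A M k 2 f [a, b, c] =
      lact M k (twist A a) (f [b, c])
      \<oplus> (\<ominus> f [prd A k a b, twist A c] \<oplus> f [twist A a, prd A k b c])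
      \<oplus> \<ominus> ract M k (f [a, b]) (twist A c)"
    using assms f
    by (simp add: hochschild_diff_def M.smult_minus_1 M.smult_assoc1
        atLeastAtMost_1_2[unfolded numeral_2_eq_2 One_nat_def] numeral_2_eq_2 numeral_3_eq_3 One_nat_def)
  also have "\<dots> = (lact M k (twist A a) (f [b, c]) \<oplus> f [twist A a, prd A k b c])
    \<ominus> (f [prd A k a b, twist A c] \<oplus> ract M k (f [a, b]) (twist A c))"
    using assms f by (simp add: a_minus_def M.M.minus_add M.M.a_ac)
  finally show ?thesis .
qed

lemma cochain_group_closed_1: "\<lbrakk>g \<in> carrier (cochain_group 1); a \<in> carrier A\<rbrakk> \<Longrightarrow> g 1 [a] \<in> carrier M"
  by (auto intro!: cochain_closed[of _ 1] simp: mem_tuples_1 carrier_cochain_group_1)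

lemma cochain_group_closed_2:
  "\<lbrakk>F \<in> carrier (cochain_group 2); k \<in> {1, 2}; a \<in> carrier A; b \<in> carrier A\<rbrakk>
    \<Longrightarrow> F k [a, b] \<in> carrier M"
  by (auto intro!: cochain_closed[of _ 2] simp: mem_tuples_2 carrier_cochain_group_2)

lemma cochain_group_eq_iff_2:
  assumes "F \<in> carrier (cochain_group 2)" "G \<in> carrier (cochain_group 2)"
  shows "F = G \<longleftrightarrow> (\<forall>k\<in>{1, 2}. \<forall>a\<in>carrier A. \<forall>b\<in>carrier A. F k [a, b] = G k [a, b])"
proof
  assume R: "\<forall>k\<in>{1, 2}. \<forall>a\<in>carrier A. \<forall>b\<in>carrier A. F k [a, b] = G k [a, b]"
  show "F = G"
    by (rule cochain_group_eqI[OF assms]) (use R in \<open>auto simp: atLeastAtMost_1_2 mem_tuples_2\<close>)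
qed simp


section \<open>Cocycles and coboundaries in degree 2\<close>

text \<open>
  If \<open>F\<close> is the factor set of an extension, \<open>assoc_left F k l a b c\<close> and \<open>assoc_right F k l a b c\<close>
  are the \<open>M\<close>-coordinates of \<open>(s a \<cdot>\<^sub>k s b) \<cdot>\<^sub>l \<alpha> (s c)\<close> and of \<open>\<alpha> (s a) \<cdot>\<^sub>k (s b \<cdot>\<^sub>l s c)\<close>, that is, of
  the two ways to bracket three lifted elements.
\<close>

definition assoc_left where
  "assoc_left F k l a b c =
    F l [prd A k a b, twist A c] \<oplus> ract M l (F k [a, b]) (twist A c)"

definition assoc_right where
  "assoc_right F k l a b c =
    lact M k (twist A a) (F l [b, c]) \<oplus> F k [twist A a, prd A l b c]"

definition cocycle where
  "cocycle F \<longleftrightarrow> F \<in> carrier (cochain_group 2) \<and>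
    (\<forall>a\<in>carrier A. \<forall>b\<in>carrier A. \<forall>c\<in>carrier A.
      (\<forall>k\<in>{1, 2}. assoc_left F k k a b c = assoc_right F k k a b c) \<and>
      assoc_left F 1 2 a b c \<oplus> assoc_left F 2 1 a b c
      = assoc_right F 1 2 a b c \<oplus> assoc_right F 2 1 a b c)"

lemma restrict_eq_iff: "restrict f S = restrict g S \<longleftrightarrow> (\<forall>x\<in>S. f x = g x)"
  by (metis restrict_apply' restrict_ext)

lemma ball_tuples_3: "(\<forall>as\<in>tuples A 3. P as) \<longleftrightarrow>
    (\<forall>a\<in>carrier A. \<forall>b\<in>carrier A. \<forall>c\<in>carrier A. P [a, b, c])"
  by (auto simp: mem_tuples_3)

lemma comp_diff_2_eq_one_iff:
  "comp_diff K A M 2 F = \<one>\<^bsub>cochain_group 3\<^esub> \<longleftrightarrow>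
    (\<forall>a\<in>carrier A. \<forall>b\<in>carrier A. \<forall>c\<in>carrier A.
      hochschild_diff K A M 1 2 (F 1) [a, b, c] = \<zero> \<and>
      hochschild_diff K A M 2 2 (F 1) [a, b, c] \<oplus> hochschild_diff K A M 1 2 (F 2) [a, b, c] = \<zero> \<and>
      hochschild_diff K A M 2 2 (F 2) [a, b, c] = \<zero>)"
proof -
  have "{1..3::nat} = {1, 2, 3}" by auto
  then show ?thesis
    unfolding comp_diff_def comp_cochain_group_def
    by (auto simp: restrict_eq_iff ball_tuples_3 One_nat_def)
qed

text \<open>
  The first and last component of the differential compare the two bracketings for a single
  product. The middle one pairs \<open>\<^sup>2\<delta> F\<^sub>1\<close> with \<open>\<^sup>1\<delta> F\<^sub>2\<close>, which regroups into the mixed bracketings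
  of the compatibility condition: \<open>F\<^sub>k\<close> inside an \<open>l\<close>-action, or evaluated at an \<open>l\<close>-product, occurs
  in both.
\<close>

lemma kernel_comp_diff_2:
  "F \<in> kernel (cochain_group 2) (cochain_group (2 + 1)) (comp_diff K A M 2) \<longleftrightarrow> cocycle F"
proof (cases "F \<in> carrier (cochain_group 2)")
  case True
  have F: "F k \<in> cochains K A M 2" if "k \<in> {1, 2}" for k
    using True that unfolding carrier_cochain_group_2 by blast
  note [simp] = cochain_group_closed_2[OF True]
  have d: "hochschild_diff K A M k 2 (F l) [a, b, c] =
      (lact M k (twist A a) (F l [b, c]) \<oplus> F l [twist A a, prd A k b c])
      \<ominus> (F l [prd A k a b, twist A c] \<oplus> ract M k (F l [a, b]) (twist A c))"
    if "k \<in> {1, 2}" "l \<in> {1, 2}" "a \<in> carrier A" "b \<in> carrier A" "c \<in> carrier A" for k l a b c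
    using that by (intro hochschild_diff_2 F)
  have "hochschild_diff K A M k 2 (F k) [a, b, c] = \<zero> \<longleftrightarrow>
      assoc_left F k k a b c = assoc_right F k k a b c"
    if "k \<in> {1, 2}" "a \<in> carrier A" "b \<in> carrier A" "c \<in> carrier A" for k a b c
    using that by (subst d) (auto simp: assoc_left_def assoc_right_def)
  moreover have "hochschild_diff K A M 2 2 (F 1) [a, b, c] \<oplus> hochschild_diff K A M 1 2 (F 2) [a, b, c] = \<zero> \<longleftrightarrow>
      assoc_left F 1 2 a b c \<oplus> assoc_left F 2 1 a b c = assoc_right F 1 2 a b c \<oplus> assoc_right F 2 1 a b c"
    if "a \<in> carrier A" "b \<in> carrier A" "c \<in> carrier A" for a b c
  proof -
    have "hochschild_diff K A M 2 2 (F 1) [a, b, c] \<oplus> hochschild_diff K A M 1 2 (F 2) [a, b, c] =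
        (assoc_right F 1 2 a b c \<oplus> assoc_right F 2 1 a b c)
        \<ominus> (assoc_left F 1 2 a b c \<oplus> assoc_left F 2 1 a b c)"
      using that by (simp add: d assoc_left_def assoc_right_def a_minus_def M.M.minus_add M.M.a_ac)
    then show ?thesis
      using that by (auto simp: assoc_left_def assoc_right_def)
  qed
  ultimately show ?thesis
    using True by (auto simp: kernel_def cocycle_def comp_diff_2_eq_one_iff)
qed (simp add: kernel_def cocycle_def)

lemma comp_diff_1:
  assumes "k \<in> {1, 2}" "g \<in> carrier (cochain_group 1)" "a \<in> carrier A" "b \<in> carrier A"
  shows "comp_diff K A M 1 g k [a, b] =
    lact M k a (g 1 [b]) \<oplus> \<ominus> g 1 [prd A k a b] \<oplus> ract M k (g 1 [a]) b"
proof -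
  have "[a, b] \<in> tuples A 2" using assms by (auto simp: mem_tuples_2)
  then have "comp_diff K A M 1 g k [a, b] = hochschild_diff K A M k 1 (g 1) [a, b]"
    using assms(1) by (auto simp: comp_diff_def)
  then show ?thesis
    using assms hochschild_diff_1[of k "g 1" a b] by (simp add: carrier_cochain_group_1)
qed

lemma linear_of_cochain_1:
  assumes "g \<in> carrier (cochain_group 1)" "a \<in> carrier A"
  shows "b \<in> carrier A \<Longrightarrow> g 1 [a \<oplus>\<^bsub>A\<^esub> b] = g 1 [a] \<oplus> g 1 [b]"
    and "c \<in> carrier K \<Longrightarrow> g 1 [c \<odot>\<^bsub>A\<^esub> a] = c \<odot> g 1 [a]"
    and "btwist M (g 1 [a]) = g 1 [twist A a]"
  using assms unfolding carrier_cochain_group_1 cochains_1_iff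
    linear_map_iff[OF A.V.vectorspace_axioms M.vectorspace_axioms] by blast+

text \<open>
  The differential of a 1-cochain is bilinear because products and actions are, and commutes
  with the twisting maps because these respect products and actions.
\<close>

lemma comp_diff_1_closed:
  assumes "g \<in> carrier (cochain_group 1)"
  shows "comp_diff K A M 1 g \<in> carrier (cochain_group 2)"
proof -
  note [simp] = cochain_group_closed_1[OF assms]
  have "comp_diff K A M 1 g k \<in> cochains K A M 2" if k: "k \<in> {1, 2}" for k
  proof -
    have "comp_diff K A M 1 g k \<in> extensional (tuples A 2)"
      using k by (auto simp: comp_diff_def)
    then show ?thesis
      unfolding cochains_2_iff bilinear_map_iff[OF A.V.vectorspace_axioms A.V.vectorspace_axioms M.vectorspace_axioms]
      using k by (simp add: comp_diff_1[OF k assms] A.prd_add_right A.prd_add_left A.prd_smult_right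
          A.prd_smult_left lact_add_right lact_add_left lact_smult_right lact_smult_left
          ract_add_right ract_add_left ract_smult_right ract_smult_left
          linear_of_cochain_1[OF assms] M.smult_r_distr M.smult_r_minus M.M.minus_add M.M.a_ac
          btwist_add btwist_minus btwist_lact btwist_ract A.twist_prd)
  qed
  moreover have "comp_diff K A M 1 g \<in> extensional {1..2}"
    by (simp add: comp_diff_def)
  ultimately show ?thesis
    unfolding carrier_cochain_group_2 by blast
qed

lemma comp_diff_1_hom: "comp_diff K A M 1 \<in> hom (cochain_group 1) (cochain_group 2)"
proof (rule homI)
  fix g h assume gh: "g \<in> carrier (cochain_group 1)" "h \<in> carrier (cochain_group 1)"
  note [simp] = cochain_group_closed_1[OF gh(1)] cochain_group_closed_1[OF gh(2)]
  have t: "[a] \<in> tuples A 1" if "a \<in> carrier A" for a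
    using that by (simp add: tuples_iff)
  have t2: "[a, b] \<in> tuples A 2" if "a \<in> carrier A" "b \<in> carrier A" for a b
    using that by (simp add: tuples_iff)
  show "comp_diff K A M 1 (g \<otimes>\<^bsub>cochain_group 1\<^esub> h) =
      comp_diff K A M 1 g \<otimes>\<^bsub>cochain_group 2\<^esub> comp_diff K A M 1 h"
  proof (subst cochain_group_eq_iff_2, goal_cases)
    case 3
    show ?case
    proof (intro ballI)
      fix k :: nat and a b
      assume *: "k \<in> {1, 2}" "a \<in> carrier A" "b \<in> carrier A"
      have k: "k \<in> {1..2}" using * by auto
      show "comp_diff K A M 1 (g \<otimes>\<^bsub>cochain_group 1\<^esub> h) k [a, b] =
          (comp_diff K A M 1 g \<otimes>\<^bsub>cochain_group 2\<^esub> comp_diff K A M 1 h) k [a, b]"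
        using * by (simp add: cochain_group_mult(1)[OF k t2] comp_diff_1 gh cochain_group_closed(1)
            cochain_group_mult(1) t lact_add_right ract_add_left M.M.minus_add M.M.a_ac)
    qed
  qed (use gh in \<open>auto intro: comp_diff_1_closed cochain_group_closed\<close>)
qed (rule comp_diff_1_closed)

abbreviation coboundaries where
  "coboundaries \<equiv> comp_diff K A M 1 ` carrier (cochain_group 1)"

lemma subgroup_coboundaries: "subgroup coboundaries (cochain_group 2)"
proof -
  interpret group_hom "cochain_group 1" "cochain_group 2" "comp_diff K A M 1"
    using comm_group_cochain_group comp_diff_1_hom
    by (simp add: group_hom_def group_hom_axioms_def comm_group_def)
  show ?thesis by (rule img_is_subgroup)
qed

abbreviation cohomology_class where
  "cohomology_class F \<equiv> coboundaries #>\<^bsub>cochain_group 2\<^esub> F"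

lemma carrier_comp_cohomology_2:
  "carrier (comp_cohomology K A M 2) = cohomology_class ` Collect cocycle"
  using kernel_comp_diff_2
  by (auto simp: comp_cohomology_def FactGroup_def RCOSETS_def r_coset_def One_nat_def)

text \<open>
  Right cosets of a subgroup agree precisely if their representatives differ by an element of
  it; a 1-cochain is unpacked to the linear map \<open>g\<close> that it encodes.
\<close>

lemma cohomology_class_eq_iff:
  assumes F: "F \<in> carrier (cochain_group 2)" and G: "G \<in> carrier (cochain_group 2)"
  shows "cohomology_class F = cohomology_class G \<longleftrightarrow>
    (\<exists>g. linear_map K A M g \<and> (\<forall>a\<in>carrier A. btwist M (g a) = g (twist A a)) \<and>
      (\<forall>k\<in>{1, 2}. \<forall>a\<in>carrier A. \<forall>b\<in>carrier A.
         F k [a, b] \<oplus> g (prd A k a b) = lact M k a (g b) \<oplus> ract M k (g a) b \<oplus> G k [a, b]))"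
proof -
  interpret C: comm_group "cochain_group 2" by (rule comm_group_cochain_group)
  have "cohomology_class F = cohomology_class G \<longleftrightarrow> F \<in> cohomology_class G"
    using C.repr_independence[OF _ G subgroup_coboundaries] C.rcos_self[OF F subgroup_coboundaries]
    by metis
  also have "\<dots> \<longleftrightarrow> (\<exists>g\<in>carrier (cochain_group 1).
      F = comp_diff K A M 1 g \<otimes>\<^bsub>cochain_group 2\<^esub> G)"
    by (auto simp: r_coset_def)
  also have "\<dots> \<longleftrightarrow> (\<exists>g\<in>carrier (cochain_group 1). \<forall>k\<in>{1, 2}. \<forall>a\<in>carrier A. \<forall>b\<in>carrier A.
         F k [a, b] \<oplus> g 1 [prd A k a b] = lact M k a (g 1 [b]) \<oplus> ract M k (g 1 [a]) b \<oplus> G k [a, b])"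
  proof (rule bex_cong[OF refl])
    fix g assume g: "g \<in> carrier (cochain_group 1)"
    have "(comp_diff K A M 1 g \<otimes>\<^bsub>cochain_group 2\<^esub> G) k [a, b] =
        (lact M k a (g 1 [b]) \<oplus> \<ominus> g 1 [prd A k a b] \<oplus> ract M k (g 1 [a]) b) \<oplus> G k [a, b]"
      if "k \<in> {1, 2}" "a \<in> carrier A" "b \<in> carrier A" for k a b
      using that by (subst cochain_group_mult) (auto simp: tuples_iff comp_diff_1[OF _ g])
    then have "F k [a, b] = (comp_diff K A M 1 g \<otimes>\<^bsub>cochain_group 2\<^esub> G) k [a, b] \<longleftrightarrow>
        F k [a, b] \<oplus> g 1 [prd A k a b] = lact M k a (g 1 [b]) \<oplus> ract M k (g 1 [a]) b \<oplus> G k [a, b]"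
      if "k \<in> {1, 2}" "a \<in> carrier A" "b \<in> carrier A" for k a b
      using that M.M.eq_alternating_sum_iff[of "F k [a, b]" "lact M k a (g 1 [b])"
          "ract M k (g 1 [a]) b" "g 1 [prd A k a b]" "G k [a, b]"]
      by (simp add: cochain_group_closed_1[OF g] cochain_group_closed_2[OF F]
          cochain_group_closed_2[OF G])
    then show "F = comp_diff K A M 1 g \<otimes>\<^bsub>cochain_group 2\<^esub> G \<longleftrightarrow>
      (\<forall>k\<in>{1, 2}. \<forall>a\<in>carrier A. \<forall>b\<in>carrier A.
         F k [a, b] \<oplus> g 1 [prd A k a b] = lact M k a (g 1 [b]) \<oplus> ract M k (g 1 [a]) b \<oplus> G k [a, b])"
      using F G g comp_diff_1_closed cochain_group_closed(1)
      by (subst cochain_group_eq_iff_2) blast+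
  qed
  also have "\<dots> \<longleftrightarrow> (\<exists>g. linear_map K A M g \<and> (\<forall>a\<in>carrier A. btwist M (g a) = g (twist A a)) \<and>
      (\<forall>k\<in>{1, 2}. \<forall>a\<in>carrier A. \<forall>b\<in>carrier A.
         F k [a, b] \<oplus> g (prd A k a b) = lact M k a (g b) \<oplus> ract M k (g a) b \<oplus> G k [a, b]))"
    (is "(\<exists>g\<in>_. ?P (\<lambda>a. g 1 [a])) \<longleftrightarrow> (\<exists>g. ?L g \<and> ?T g \<and> ?P g)")
  proof
    assume "\<exists>g\<in>carrier (cochain_group 1). ?P (\<lambda>a. g 1 [a])"
    then obtain g where "g \<in> carrier (cochain_group 1)" "?P (\<lambda>a. g 1 [a])" by blast
    then show "\<exists>g. ?L g \<and> ?T g \<and> ?P g"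
      unfolding carrier_cochain_group_1 cochains_1_iff
      by (intro exI[of _ "\<lambda>a. g 1 [a]"]) blast
  next
    assume "\<exists>g. ?L g \<and> ?T g \<and> ?P g"
    then obtain g where g: "?L g" "?T g" "?P g" by blast
    define h where "h = (\<lambda>i\<in>{1..1::nat}. \<lambda>as\<in>tuples A 1. g (hd as))"
    have eq: "h 1 [a] = g a" if "a \<in> carrier A" for a
      using that by (simp add: h_def tuples_iff)
    have "h \<in> carrier (cochain_group 1)"
      unfolding carrier_cochain_group_1 cochains_1_iff
        linear_map_iff[OF A.V.vectorspace_axioms M.vectorspace_axioms]
      using g(1,2) by (simp add: linear_map_iff[OF A.V.vectorspace_axioms M.vectorspace_axioms]
          tuples_iff h_def)
    moreover have "?P (\<lambda>a. h 1 [a])"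
      using g(3) by (simp add: eq)
    ultimately show "\<exists>g\<in>carrier (cochain_group 1). ?P (\<lambda>a. g 1 [a])"
      by blast
  qed
  finally show ?thesis .
qed

end

section \<open>Coordinates on an abelian extension\<close>

lemma trivial_comp_alg_simps [simp]:
  "carrier (trivial_comp_alg M) = carrier M"
  "add (trivial_comp_alg M) = add M"
  "zero (trivial_comp_alg M) = zero M"
  "smult (trivial_comp_alg M) = smult M"
  "prd (trivial_comp_alg M) k m n = \<zero>\<^bsub>M\<^esub>"
  "twist (trivial_comp_alg M) = btwist M"
  by (simp_all add: trivial_comp_alg_def)

locale inducing_extension = compatible_bimodule K A M
  for K :: "('k, 'x) ring_scheme" and A :: "('k, 'a) comp_alg"
    and M :: "('k, 'a, 'm) comp_bimod" +
  fixes X :: "('k, 'a, 'm, 'e) extension"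
  assumes inducing: "X \<in> extensions_inducing K A M"
begin

sublocale abelian_extension K A M X
  using inducing by (simp add: extensions_inducing_def)

sublocale E: compatible_hom_assoc_algebra K "total X"
  by (rule total_algebra)

lemma vectorspace_trivial: "vectorspace K (trivial_comp_alg M)"
  using incl_morphism by (simp add: comp_alg_morphism_def linear_map_def)

lemma
  assumes "m \<in> carrier M"
  shows incl_closed [simp]: "incl X m \<in> carrier (total X)"
    and incl_add: "n \<in> carrier M \<Longrightarrow> incl X (m \<oplus>\<^bsub>M\<^esub> n) = incl X m \<oplus>\<^bsub>total X\<^esub> incl X n"
    and incl_smult: "c \<in> carrier K \<Longrightarrow> incl X (c \<odot>\<^bsub>M\<^esub> m) = c \<odot>\<^bsub>total X\<^esub> incl X m"
    and incl_twist: "twist (total X) (incl X m) = incl X (btwist M m)"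
  using incl_morphism assms
  unfolding comp_alg_morphism_def linear_map_iff[OF vectorspace_trivial E.V.vectorspace_axioms]
  by simp_all

lemma incl_prd:
  assumes "k \<in> {1, 2}" "m \<in> carrier M" "n \<in> carrier M"
  shows "prd (total X) k (incl X m) (incl X n) = incl X \<zero>\<^bsub>M\<^esub>"
proof -
  have "incl X (prd (trivial_comp_alg M) k m n) = prd (total X) k (incl X m) (incl X n)"
    using incl_morphism assms unfolding comp_alg_morphism_def trivial_comp_alg_simps by blast
  then show ?thesis by simp
qed

lemma incl_zero [simp]: "incl X \<zero>\<^bsub>M\<^esub> = \<zero>\<^bsub>total X\<^esub>"
  by (intro M.additive_zero) (simp_all add: E.V.M.abelian_group_axioms incl_add)

lemma
  assumes "x \<in> carrier (total X)"
  shows proj_closed [simp]: "proj X x \<in> carrier A"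
    and proj_add: "y \<in> carrier (total X) \<Longrightarrow> proj X (x \<oplus>\<^bsub>total X\<^esub> y) = proj X x \<oplus>\<^bsub>A\<^esub> proj X y"
    and proj_smult: "c \<in> carrier K \<Longrightarrow> proj X (c \<odot>\<^bsub>total X\<^esub> x) = c \<odot>\<^bsub>A\<^esub> proj X x"
    and proj_twist: "proj X (twist (total X) x) = twist A (proj X x)"
  using proj_morphism assms
  unfolding comp_alg_morphism_def linear_map_iff[OF E.V.vectorspace_axioms A.V.vectorspace_axioms]
  by simp_all

lemma proj_prd:
  assumes "k \<in> {1, 2}" "x \<in> carrier (total X)" "y \<in> carrier (total X)"
  shows "proj X (prd (total X) k x y) = prd A k (proj X x) (proj X y)"
  using proj_morphism assms unfolding comp_alg_morphism_def by blast

lemma proj_incl [simp]: "m \<in> carrier M \<Longrightarrow> proj X (incl X m) = \<zero>\<^bsub>A\<^esub>"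
  using exact by blast

lemma
  assumes "a \<in> carrier A"
  shows sect_closed [simp]: "sect X a \<in> carrier (total X)"
    and sect_add: "b \<in> carrier A \<Longrightarrow> sect X (a \<oplus>\<^bsub>A\<^esub> b) = sect X a \<oplus>\<^bsub>total X\<^esub> sect X b"
    and sect_smult: "c \<in> carrier K \<Longrightarrow> sect X (c \<odot>\<^bsub>A\<^esub> a) = c \<odot>\<^bsub>total X\<^esub> sect X a"
  using sect_linear assms
  unfolding linear_map_iff[OF A.V.vectorspace_axioms E.V.vectorspace_axioms] by simp_all

lemma sect_zero [simp]: "sect X \<zero>\<^bsub>A\<^esub> = \<zero>\<^bsub>total X\<^esub>"
  by (intro A.V.additive_zero) (simp_all add: E.V.M.abelian_group_axioms sect_add)

lemmas sect_splits [simp]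

lemma
  assumes "k \<in> {1, 2}" "a \<in> carrier A" "m \<in> carrier M"
  shows sect_prd_incl: "prd (total X) k (sect X a) (incl X m) = incl X (lact M k a m)"
    and incl_prd_sect: "prd (total X) k (incl X m) (sect X a) = incl X (ract M k m a)"
proof -
  have *: "x = incl X n" if "inv_into (carrier M) (incl X) x = n"
      "x \<in> carrier (total X)" "proj X x = \<zero>\<^bsub>A\<^esub>" for x n
  proof -
    have "x \<in> incl X ` carrier M" using that exact by simp
    then show ?thesis using that(1) by (metis f_inv_into_f)
  qed
  have "induced_lact M X k a m = lact M k a m" "induced_ract M X k m a = ract M k m a"
    using inducing assms by (auto simp: extensions_inducing_def)
  then show "prd (total X) k (sect X a) (incl X m) = incl X (lact M k a m)"
    "prd (total X) k (incl X m) (sect X a) = incl X (ract M k m a)"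
    using assms by (auto intro!: * simp: induced_lact_def induced_ract_def proj_prd)
qed

text \<open>
  The \<open>M\<close>-coordinate of \<open>e\<close>: the difference of \<open>e\<close> and the lift of its image in \<open>A\<close> lies in the
  kernel of the projection, hence in the image of \<open>M\<close>. Together with the projection it determines
  \<open>e\<close>, so identities in the total space are checked on the two coordinates.
\<close>

definition fibre where
  "fibre e = inv_into (carrier M) (incl X) (e \<ominus>\<^bsub>total X\<^esub> sect X (proj X e))"

lemma
  assumes "e \<in> carrier (total X)"
  shows fibre_closed [simp]: "fibre e \<in> carrier M"
    and decomposition: "sect X (proj X e) \<oplus>\<^bsub>total X\<^esub> incl X (fibre e) = e"
proof -
  let ?d = "e \<ominus>\<^bsub>total X\<^esub> sect X (proj X e)"
  interpret j: linear_map K "total X" A "proj X"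
    using proj_morphism by (simp add: comp_alg_morphism_def)
  have d: "?d \<in> incl X ` carrier M"
    using assms by (simp add: exact A.V.M.r_neg a_minus_def)
  then show "fibre e \<in> carrier M"
    unfolding fibre_def by (rule inv_into_into)
  have "incl X (fibre e) = ?d"
    using d unfolding fibre_def by (rule f_inv_into_f)
  then show "sect X (proj X e) \<oplus>\<^bsub>total X\<^esub> incl X (fibre e) = e"
    using assms by (simp add: a_minus_def E.V.M.a_ac E.V.M.r_neg)
qed

lemma
  assumes "a \<in> carrier A" "m \<in> carrier M"
  shows proj_coords: "proj X (sect X a \<oplus>\<^bsub>total X\<^esub> incl X m) = a"
    and fibre_coords: "fibre (sect X a \<oplus>\<^bsub>total X\<^esub> incl X m) = m"
proof -
  let ?e = "sect X a \<oplus>\<^bsub>total X\<^esub> incl X m"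
  show j: "proj X ?e = a" using assms by (simp add: proj_add)
  have "sect X a \<oplus>\<^bsub>total X\<^esub> incl X (fibre ?e) = sect X a \<oplus>\<^bsub>total X\<^esub> incl X m"
    using decomposition[of ?e] assms by (simp add: j)
  then have "incl X (fibre ?e) = incl X m"
    using assms by simp
  then show "fibre ?e = m"
    using incl_inj assms by (simp add: inj_on_eq_iff)
qed

lemma fibre_eqI:
  assumes "e = sect X a \<oplus>\<^bsub>total X\<^esub> incl X m" "a \<in> carrier A" "m \<in> carrier M"
  shows "fibre e = m"
  using assms fibre_coords by simp

lemma coords_eqI:
  assumes "x \<in> carrier (total X)" "y \<in> carrier (total X)" "proj X x = proj X y" "fibre x = fibre y"
  shows "x = y"
  using assms decomposition by metis

lemma fibre_incl [simp]: "m \<in> carrier M \<Longrightarrow> fibre (incl X m) = m"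
  by (rule fibre_eqI[of _ "\<zero>\<^bsub>A\<^esub>"]) simp_all

lemma fibre_sect [simp]: "a \<in> carrier A \<Longrightarrow> fibre (sect X a) = \<zero>\<^bsub>M\<^esub>"
  by (rule fibre_eqI[of _ a]) simp_all

lemma fibre_add:
  assumes "x \<in> carrier (total X)" "y \<in> carrier (total X)"
  shows "fibre (x \<oplus>\<^bsub>total X\<^esub> y) = fibre x \<oplus>\<^bsub>M\<^esub> fibre y"
proof (rule fibre_eqI)
  have "x \<oplus>\<^bsub>total X\<^esub> y = (sect X (proj X x) \<oplus>\<^bsub>total X\<^esub> incl X (fibre x))
      \<oplus>\<^bsub>total X\<^esub> (sect X (proj X y) \<oplus>\<^bsub>total X\<^esub> incl X (fibre y))"
    using assms by (simp add: decomposition)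
  then show "x \<oplus>\<^bsub>total X\<^esub> y = sect X (proj X x \<oplus>\<^bsub>A\<^esub> proj X y)
      \<oplus>\<^bsub>total X\<^esub> incl X (fibre x \<oplus>\<^bsub>M\<^esub> fibre y)"
    using assms by (simp add: sect_add incl_add E.V.M.a_ac)
qed (use assms in simp_all)

lemma fibre_smult:
  assumes "c \<in> carrier K" "x \<in> carrier (total X)"
  shows "fibre (c \<odot>\<^bsub>total X\<^esub> x) = c \<odot>\<^bsub>M\<^esub> fibre x"
proof (rule fibre_eqI)
  have "c \<odot>\<^bsub>total X\<^esub> x = c \<odot>\<^bsub>total X\<^esub> (sect X (proj X x) \<oplus>\<^bsub>total X\<^esub> incl X (fibre x))"
    using assms by (simp add: decomposition)
  then show "c \<odot>\<^bsub>total X\<^esub> x = sect X (c \<odot>\<^bsub>A\<^esub> proj X x) \<oplus>\<^bsub>total X\<^esub> incl X (c \<odot>\<^bsub>M\<^esub> fibre x)"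
    using assms by (simp add: sect_smult incl_smult E.V.smult_r_distr)
qed (use assms in simp_all)

lemma fibre_twist:
  assumes "x \<in> carrier (total X)"
  shows "fibre (twist (total X) x) = btwist M (fibre x)"
proof (rule fibre_eqI)
  have "twist (total X) x = twist (total X) (sect X (proj X x) \<oplus>\<^bsub>total X\<^esub> incl X (fibre x))"
    using assms by (simp add: decomposition)
  then show "twist (total X) x = sect X (twist A (proj X x)) \<oplus>\<^bsub>total X\<^esub> incl X (btwist M (fibre x))"
    using assms by (simp add: E.twist_add sect_twist incl_twist)
qed (use assms in simp_all)

text \<open>
  As the products of the quotient are those of \<open>A\<close>, this is the defect
  \<open>s a \<cdot>\<^sub>k s b - s (a \<cdot>\<^sub>k b)\<close> of multiplicativity of the splitting, read in \<open>M\<close>.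
\<close>

definition factor_set where
  "factor_set = (\<lambda>k\<in>{1..2}. \<lambda>as\<in>tuples A 2.
    fibre (prd (total X) k (sect X (as ! 0)) (sect X (as ! 1))))"

lemma factor_set:
  assumes "k \<in> {1, 2}" "a \<in> carrier A" "b \<in> carrier A"
  shows "factor_set k [a, b] = fibre (prd (total X) k (sect X a) (sect X b))"
  using assms by (auto simp: factor_set_def tuples_iff)

lemma factor_set_closed [simp]:
  assumes "k \<in> {1, 2}" "a \<in> carrier A" "b \<in> carrier A"
  shows "factor_set k [a, b] \<in> carrier M"
  using assms by (simp add: factor_set)

text \<open>
  Expanding both arguments as lift plus element of \<open>M\<close> gives four products: that of the lifts is
  measured by the factor set, the mixed ones are the induced actions, and the product of two
  elements of \<open>M\<close> vanishes. So the factor set determines the multiplication.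
\<close>

lemma fibre_prd:
  assumes "k \<in> {1, 2}" "x \<in> carrier (total X)" "y \<in> carrier (total X)"
  shows "fibre (prd (total X) k x y) = factor_set k [proj X x, proj X y]
    \<oplus>\<^bsub>M\<^esub> lact M k (proj X x) (fibre y) \<oplus>\<^bsub>M\<^esub> ract M k (fibre x) (proj X y)"
proof -
  have "prd (total X) k x y =
      prd (total X) k (sect X (proj X x) \<oplus>\<^bsub>total X\<^esub> incl X (fibre x))
        (sect X (proj X y) \<oplus>\<^bsub>total X\<^esub> incl X (fibre y))"
    using assms by (simp add: decomposition)
  also have "\<dots> = (prd (total X) k (sect X (proj X x)) (sect X (proj X y))
      \<oplus>\<^bsub>total X\<^esub> incl X (lact M k (proj X x) (fibre y)))
      \<oplus>\<^bsub>total X\<^esub> incl X (ract M k (fibre x) (proj X y))"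
    using assms by (simp add: E.prd_add_left E.prd_add_right sect_prd_incl incl_prd_sect incl_prd
        E.V.M.a_ac)
  finally show ?thesis
    using assms by (simp add: fibre_add factor_set)
qed

lemma factor_set_cochain: "factor_set \<in> carrier (cochain_group 2)"
proof -
  have "factor_set k \<in> cochains K A M 2" if k: "k \<in> {1, 2}" for k
  proof -
    have "factor_set k \<in> extensional (tuples A 2)"
      using k by (auto simp: factor_set_def)
    then show ?thesis
      unfolding cochains_2_iff
        bilinear_map_iff[OF A.V.vectorspace_axioms A.V.vectorspace_axioms M.vectorspace_axioms]
      using k by (simp add: factor_set sect_add sect_smult E.prd_add_left E.prd_add_right
          E.prd_smult_left E.prd_smult_right fibre_add fibre_smult E.twist_prd sect_twist
          flip: fibre_twist)
  qed
  moreover have "factor_set \<in> extensional {1..2}"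
    by (simp add: factor_set_def)
  ultimately show ?thesis
    unfolding carrier_cochain_group_2 by blast
qed

lemma factor_set_assoc:
  assumes kl: "k \<in> {1, 2}" "l \<in> {1, 2}" and "a \<in> carrier A" "b \<in> carrier A" "c \<in> carrier A"
  shows "fibre (prd (total X) l (prd (total X) k (sect X a) (sect X b)) (twist (total X) (sect X c)))
      = assoc_left factor_set k l a b c"
    and "fibre (prd (total X) k (twist (total X) (sect X a)) (prd (total X) l (sect X b) (sect X c)))
      = assoc_right factor_set k l a b c"
  using assms by (simp_all add: fibre_prd sect_twist proj_prd factor_set[symmetric]
      assoc_left_def assoc_right_def M.M.a_ac)

text \<open>
  The identities of the total algebra, applied to lifts and read in the \<open>M\<close>-coordinate.
\<close>

lemma factor_set_cocycle: "cocycle factor_set"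
proof -
  have "assoc_left factor_set k k a b c = assoc_right factor_set k k a b c"
    if "k \<in> {1, 2}" "a \<in> carrier A" "b \<in> carrier A" "c \<in> carrier A" for k a b c
    using that by (simp add: E.prd_assoc flip: factor_set_assoc)
  moreover have "assoc_left factor_set 1 2 a b c \<oplus>\<^bsub>M\<^esub> assoc_left factor_set 2 1 a b c
      = assoc_right factor_set 1 2 a b c \<oplus>\<^bsub>M\<^esub> assoc_right factor_set 2 1 a b c"
    if "a \<in> carrier A" "b \<in> carrier A" "c \<in> carrier A" for a b c
    using that E.compatible[of "sect X a" "sect X b" "sect X c"]
    by (simp flip: factor_set_assoc fibre_add)
  ultimately show ?thesis
    using factor_set_cochain by (simp add: cocycle_def)
qed

end


section \<open>Equivalence of extensions\<close>

text \<open>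
  A morphism of extensions fixes \<open>M\<close> and the image in \<open>A\<close>, so it is determined by the linear map
  \<open>g\<close> sending \<open>a\<close> to the \<open>M\<close>-coordinate of the image of the lift of \<open>a\<close>. Multiplicativity on lifts
  is the coboundary equation for \<open>g\<close>; conversely, since all other terms of the product formula
  are determined by the bimodule structure, this equation makes the shear \<open>(a, m) \<mapsto> (a, g a + m)\<close>
  multiplicative everywhere.
\<close>

lemma (in compatible_bimodule) extension_equiv_iff:
  fixes X Y :: "('k, 'a, 'm, 'e) extension"
  assumes "X \<in> extensions_inducing K A M" "Y \<in> extensions_inducing K A M"
  shows "(X, Y) \<in> extension_equiv K A M \<longleftrightarrow>
    cohomology_class (inducing_extension.factor_set A M X)
    = cohomology_class (inducing_extension.factor_set A M Y)"
proof -
  interpret X: inducing_extension K A M X using assms by unfold_locales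
  interpret Y: inducing_extension K A M Y using assms by unfold_locales
  note lin_iff = linear_map_iff[OF X.E.V.vectorspace_axioms Y.E.V.vectorspace_axioms]
    linear_map_iff[OF A.V.vectorspace_axioms M.vectorspace_axioms]
  show ?thesis
    unfolding cohomology_class_eq_iff[OF X.factor_set_cochain Y.factor_set_cochain]
  proof
    assume "(X, Y) \<in> extension_equiv K A M"
    then obtain \<phi> where mor: "comp_alg_morphism K (total X) (total Y) \<phi>"
      and \<phi>_incl: "\<And>m. m \<in> carrier M \<Longrightarrow> \<phi> (incl X m) = incl Y m"
      and \<phi>_proj: "\<And>e. e \<in> carrier (total X) \<Longrightarrow> proj Y (\<phi> e) = proj X e"
      unfolding extension_equiv_def by blast
    have \<phi>: "\<And>x. x \<in> carrier (total X) \<Longrightarrow> \<phi> x \<in> carrier (total Y)"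
      "\<And>x y. x \<in> carrier (total X) \<Longrightarrow> y \<in> carrier (total X)
        \<Longrightarrow> \<phi> (x \<oplus>\<^bsub>total X\<^esub> y) = \<phi> x \<oplus>\<^bsub>total Y\<^esub> \<phi> y"
      "\<And>c x. c \<in> carrier K \<Longrightarrow> x \<in> carrier (total X) \<Longrightarrow> \<phi> (c \<odot>\<^bsub>total X\<^esub> x) = c \<odot>\<^bsub>total Y\<^esub> \<phi> x"
      "\<And>k x y. k \<in> {1, 2} \<Longrightarrow> x \<in> carrier (total X) \<Longrightarrow> y \<in> carrier (total X)
        \<Longrightarrow> \<phi> (prd (total X) k x y) = prd (total Y) k (\<phi> x) (\<phi> y)"
      "\<And>x. x \<in> carrier (total X) \<Longrightarrow> \<phi> (twist (total X) x) = twist (total Y) (\<phi> x)"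
      using mor unfolding comp_alg_morphism_def lin_iff by blast+
    define g where "g a = Y.fibre (\<phi> (sect X a))" for a
    have g_closed [simp]: "g a \<in> carrier M" if "a \<in> carrier A" for a
      using that by (simp add: g_def \<phi>)
    have "linear_map K A M g"
      unfolding lin_iff using \<phi>
      by (simp add: g_def X.sect_add X.sect_smult Y.fibre_add Y.fibre_smult)
    moreover have "btwist M (g a) = g (twist A a)" if "a \<in> carrier A" for a
      using that \<phi> by (simp add: g_def flip: Y.fibre_twist X.sect_twist)
    moreover have "X.factor_set k [a, b] \<oplus> g (prd A k a b)
        = lact M k a (g b) \<oplus> ract M k (g a) b \<oplus> Y.factor_set k [a, b]"
      if "k \<in> {1, 2}" "a \<in> carrier A" "b \<in> carrier A" for k a b
    proof -
      have fibre_\<phi>: "Y.fibre (\<phi> e) = g (proj X e) \<oplus> X.fibre e" if e: "e \<in> carrier (total X)" for e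
      proof -
        have "\<phi> e = \<phi> (sect X (proj X e) \<oplus>\<^bsub>total X\<^esub> incl X (X.fibre e))"
          using e by (simp add: X.decomposition)
        then show ?thesis
          using e by (simp add: \<phi> \<phi>_incl Y.fibre_add g_def)
      qed
      have "Y.fibre (\<phi> (prd (total X) k (sect X a) (sect X b)))
          = Y.fibre (prd (total Y) k (\<phi> (sect X a)) (\<phi> (sect X b)))"
        using that by (simp add: \<phi>)
      then show ?thesis
        using that by (simp add: fibre_\<phi> Y.fibre_prd \<phi>(1) \<phi>_proj X.proj_prd X.fibre_prd M.M.a_ac)
    qed
    ultimately show "\<exists>g. linear_map K A M g \<and> (\<forall>a\<in>carrier A. btwist M (g a) = g (twist A a)) \<and>
      (\<forall>k\<in>{1, 2}. \<forall>a\<in>carrier A. \<forall>b\<in>carrier A. X.factor_set k [a, b] \<oplus> g (prd A k a b)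
         = lact M k a (g b) \<oplus> ract M k (g a) b \<oplus> Y.factor_set k [a, b])"
      by blast
  next
    assume "\<exists>g. linear_map K A M g \<and> (\<forall>a\<in>carrier A. btwist M (g a) = g (twist A a)) \<and>
      (\<forall>k\<in>{1, 2}. \<forall>a\<in>carrier A. \<forall>b\<in>carrier A. X.factor_set k [a, b] \<oplus> g (prd A k a b)
         = lact M k a (g b) \<oplus> ract M k (g a) b \<oplus> Y.factor_set k [a, b])"
    then obtain g where
      g: "\<And>a. a \<in> carrier A \<Longrightarrow> g a \<in> carrier M"
        "\<And>a b. a \<in> carrier A \<Longrightarrow> b \<in> carrier A \<Longrightarrow> g (a \<oplus>\<^bsub>A\<^esub> b) = g a \<oplus> g b"
        "\<And>c a. c \<in> carrier K \<Longrightarrow> a \<in> carrier A \<Longrightarrow> g (c \<odot>\<^bsub>A\<^esub> a) = c \<odot> g a"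
      and g_twist: "\<And>a. a \<in> carrier A \<Longrightarrow> btwist M (g a) = g (twist A a)"
      and g_prd: "\<And>k a b. k \<in> {1, 2} \<Longrightarrow> a \<in> carrier A \<Longrightarrow> b \<in> carrier A \<Longrightarrow>
        X.factor_set k [a, b] \<oplus> g (prd A k a b)
        = lact M k a (g b) \<oplus> ract M k (g a) b \<oplus> Y.factor_set k [a, b]"
      unfolding lin_iff by blast
    have g_zero [simp]: "g \<zero>\<^bsub>A\<^esub> = \<zero>"
      using g by (intro A.V.additive_zero) (simp_all add: M.M.abelian_group_axioms)
    define \<phi> where "\<phi> e = sect Y (proj X e) \<oplus>\<^bsub>total Y\<^esub> incl Y (g (proj X e) \<oplus> X.fibre e)" for e
    have \<phi>: "\<phi> e \<in> carrier (total Y)" "proj Y (\<phi> e) = proj X e"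
        "Y.fibre (\<phi> e) = g (proj X e) \<oplus> X.fibre e" if "e \<in> carrier (total X)" for e
      using that g(1) by (simp_all add: \<phi>_def Y.proj_coords Y.fibre_coords)
    have "linear_map K (total X) (total Y) \<phi>"
      unfolding lin_iff
    proof (intro conjI ballI)
      fix x y assume xy: "x \<in> carrier (total X)" "y \<in> carrier (total X)"
      show "\<phi> (x \<oplus>\<^bsub>total X\<^esub> y) = \<phi> x \<oplus>\<^bsub>total Y\<^esub> \<phi> y"
        by (rule Y.coords_eqI) (use xy g in \<open>simp_all add: \<phi> X.proj_add Y.proj_add X.fibre_add
          Y.fibre_add M.M.a_ac\<close>)
    next
      fix c x assume cx: "c \<in> carrier K" "x \<in> carrier (total X)"
      show "\<phi> (c \<odot>\<^bsub>total X\<^esub> x) = c \<odot>\<^bsub>total Y\<^esub> \<phi> x"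
        by (rule Y.coords_eqI) (use cx g in \<open>simp_all add: \<phi> X.proj_smult Y.proj_smult X.fibre_smult
          Y.fibre_smult M.smult_r_distr\<close>)
    qed (rule \<phi>)
    moreover have "\<phi> (prd (total X) k x y) = prd (total Y) k (\<phi> x) (\<phi> y)"
      if "k \<in> {1, 2}" "x \<in> carrier (total X)" "y \<in> carrier (total X)" for k x y
    proof (rule Y.coords_eqI)
      let ?a = "proj X x" and ?b = "proj X y"
      have "Y.fibre (\<phi> (prd (total X) k x y)) = (X.factor_set k [?a, ?b] \<oplus> g (prd A k ?a ?b))
          \<oplus> lact M k ?a (X.fibre y) \<oplus> ract M k (X.fibre x) ?b"
        using that g(1) by (simp add: \<phi> X.proj_prd X.fibre_prd M.M.a_ac)
      also have "\<dots> = (lact M k ?a (g ?b) \<oplus> ract M k (g ?a) ?b \<oplus> Y.factor_set k [?a, ?b])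
          \<oplus> lact M k ?a (X.fibre y) \<oplus> ract M k (X.fibre x) ?b"
        using that by (simp only: g_prd X.proj_closed)
      also have "\<dots> = Y.fibre (prd (total Y) k (\<phi> x) (\<phi> y))"
        using that g(1)
        by (simp add: \<phi> Y.fibre_prd lact_add_right ract_add_left M.M.a_ac)
      finally show "Y.fibre (\<phi> (prd (total X) k x y)) = Y.fibre (prd (total Y) k (\<phi> x) (\<phi> y))" .
    qed (use that g(1) in \<open>simp_all add: \<phi> X.proj_prd Y.proj_prd\<close>)
    moreover have "\<phi> (twist (total X) x) = twist (total Y) (\<phi> x)" if "x \<in> carrier (total X)" for x
      by (rule Y.coords_eqI) (use that g(1) in \<open>simp_all add: \<phi> X.proj_twist Y.proj_twist
        X.fibre_twist Y.fibre_twist btwist_add g_twist\<close>)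
    moreover have "\<phi> (incl X m) = incl Y m" if "m \<in> carrier M" for m
      using that by (simp add: \<phi>_def)
    ultimately show "(X, Y) \<in> extension_equiv K A M"
      unfolding extension_equiv_def comp_alg_morphism_def using assms \<phi>(2) by blast
  qed
qed


section \<open>Realising a cocycle\<close>

lemma image_span_subset:
  assumes T: "linear_map K V W T"
    and "S \<subseteq> carrier V" "T ` S \<subseteq> U" and U: "submodule K U W"
  shows "T ` module.span K V S \<subseteq> U"
proof -
  interpret V: vectorspace K V using T by (simp add: linear_map_def)
  interpret T: linear_map K V W T by (rule T)
  have "submodule K {v \<in> carrier V. T v \<in> U} V"
  proof -
    interpret U: submodule K U W by (rule U)
    show ?thesis
      by unfold_locales (simp_all add: T.T_add T.T_smult)
  qed
  moreover have "S \<subseteq> {v \<in> carrier V. T v \<in> U}"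
    using assms(2,3) by blast
  ultimately have "module.span K V S \<subseteq> {v \<in> carrier V. T v \<in> U}"
    by (intro V.span_is_subset)
  then show ?thesis by blast
qed

text \<open>
  Images of finite generating sets of \<open>U\<close> and \<open>V\<close> together generate \<open>W\<close>. This provides finite
  dimensionality of the total space, which is the sum of copies of \<open>A\<close> and \<open>M\<close>.
\<close>

lemma fin_dim_sum_of_images:
  assumes f: "linear_map K U W f" and g: "linear_map K V W g"
    and U: "vectorspace.fin_dim K U" and V: "vectorspace.fin_dim K V"
    and sum: "\<And>w. w \<in> carrier W \<Longrightarrow> \<exists>u\<in>carrier U. \<exists>v\<in>carrier V. w = f u \<oplus>\<^bsub>W\<^esub> g v"
  shows "vectorspace.fin_dim K W"
proof -
  interpret U: vectorspace K U using f by (simp add: linear_map_def)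
  interpret V: vectorspace K V using g by (simp add: linear_map_def)
  interpret W: vectorspace K W using f by (simp add: linear_map_def)
  interpret f: linear_map K U W f by (rule f)
  interpret g: linear_map K V W g by (rule g)
  obtain S where S: "finite S" "S \<subseteq> carrier U" "module.span K U S = carrier U"
    using U unfolding U.fin_dim_def by (elim exE conjE)
  obtain T where T: "finite T" "T \<subseteq> carrier V" "module.span K V T = carrier V"
    using V unfolding V.fin_dim_def by (elim exE conjE)
  let ?B = "f ` S \<union> g ` T"
  have B: "?B \<subseteq> carrier W" 
    using S(2) T(2) by (intro Un_least image_subsetI f.T_im g.T_im) (simp_all only: subsetD)
  interpret span: submodule K "module.span K W ?B" W by (rule W.span_is_submodule[OF B])
  have "f ` carrier U \<subseteq> module.span K W ?B" "g ` carrier V \<subseteq> module.span K W ?B"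
    using image_span_subset[OF f S(2) _ span.submodule_axioms]
      image_span_subset[OF g T(2) _ span.submodule_axioms] W.in_own_span[OF B]
    unfolding S(3) T(3) by (simp_all only: Un_subset_iff subset_trans)
  then have in_span: "\<And>u. u \<in> carrier U \<Longrightarrow> f u \<in> module.span K W ?B"
      "\<And>v. v \<in> carrier V \<Longrightarrow> g v \<in> module.span K W ?B"
    by (simp_all only: image_subset_iff)
  have "carrier W \<subseteq> module.span K W ?B"
  proof
    fix w assume "w \<in> carrier W"
    then obtain u v where "u \<in> carrier U" "v \<in> carrier V" "w = f u \<oplus>\<^bsub>W\<^esub> g v"
      using sum by blast
    then show "w \<in> module.span K W ?B"
      using span.m_closed in_span by simp
  qed
  then have "module.span K W ?B = carrier W"
    using W.span_is_subset2[OF B] by (intro equalityI)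
  then show ?thesis
    using S(1) T(1) B unfolding W.fin_dim_def by (intro exI[of _ ?B]) simp
qed


text \<open>
  The extension of \<open>A\<close> by \<open>M\<close> with prescribed factor set \<open>F\<close>, living on the image of
  \<open>A \<times> M\<close> under an injection \<open>emb\<close> into the type of elements of the total spaces.
\<close>

locale twisted_product = compatible_bimodule K A M
  for K :: "('k, 'x) ring_scheme" and A :: "('k, 'a) comp_alg"
    and M :: "('k, 'a, 'm) comp_bimod" +
  fixes emb :: "'a \<times> 'm \<Rightarrow> 'e" and F :: "nat \<Rightarrow> 'a list \<Rightarrow> 'm"
  assumes inj: "inj_on emb (carrier A \<times> carrier M)" and cocycle: "cocycle F"
begin

definition base where "base e = fst (inv_into (carrier A \<times> carrier M) emb e)"
definition height where "height e = snd (inv_into (carrier A \<times> carrier M) emb e)"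

definition E :: "('k, 'e) comp_alg" where
  "E = \<lparr>carrier = emb ` (carrier A \<times> carrier M), monoid.mult = undefined, monoid.one = undefined,
     zero = emb (\<zero>\<^bsub>A\<^esub>, \<zero>\<^bsub>M\<^esub>),
     add = (\<lambda>x y. emb (base x \<oplus>\<^bsub>A\<^esub> base y, height x \<oplus>\<^bsub>M\<^esub> height y)),
     smult = (\<lambda>c x. emb (c \<odot>\<^bsub>A\<^esub> base x, c \<odot>\<^bsub>M\<^esub> height x)),
     prd = (\<lambda>k x y. emb (prd A k (base x) (base y), F k [base x, base y]
       \<oplus>\<^bsub>M\<^esub> lact M k (base x) (height y) \<oplus>\<^bsub>M\<^esub> ract M k (height x) (base y))),
     twist = (\<lambda>x. emb (twist A (base x), btwist M (height x)))\<rparr>"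

definition X :: "('k, 'a, 'm, 'e) extension" where
  "X = \<lparr>total = E, incl = (\<lambda>m. emb (\<zero>\<^bsub>A\<^esub>, m)), proj = base, sect = (\<lambda>a. emb (a, \<zero>\<^bsub>M\<^esub>))\<rparr>"

lemma
  assumes "a \<in> carrier A" "m \<in> carrier M"
  shows base [simp]: "base (emb (a, m)) = a" and height [simp]: "height (emb (a, m)) = m"
    and emb_closed [simp]: "emb (a, m) \<in> carrier E"
  using assms inj by (simp_all add: base_def height_def E_def)

lemma emb_eq_iff [simp]:
  "\<lbrakk>a \<in> carrier A; m \<in> carrier M; b \<in> carrier A; n \<in> carrier M\<rbrakk>
    \<Longrightarrow> emb (a, m) = emb (b, n) \<longleftrightarrow> a = b \<and> m = n"
  using inj by (auto simp: inj_on_eq_iff)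

lemma carrier_cases:
  assumes "e \<in> carrier E"
  obtains a m where "a \<in> carrier A" "m \<in> carrier M" "e = emb (a, m)"
  using assms by (auto simp: E_def)

lemma ball_carrier:
  "(\<forall>e\<in>carrier E. P e) \<longleftrightarrow> (\<forall>a\<in>carrier A. \<forall>m\<in>carrier M. P (emb (a, m)))"
  by (auto simp: E_def)

lemma
  assumes "a \<in> carrier A" "m \<in> carrier M"
  shows add_emb [simp]: "\<lbrakk>b \<in> carrier A; n \<in> carrier M\<rbrakk>
      \<Longrightarrow> emb (a, m) \<oplus>\<^bsub>E\<^esub> emb (b, n) = emb (a \<oplus>\<^bsub>A\<^esub> b, m \<oplus>\<^bsub>M\<^esub> n)"
    and smult_emb [simp]: "c \<odot>\<^bsub>E\<^esub> emb (a, m) = emb (c \<odot>\<^bsub>A\<^esub> a, c \<odot>\<^bsub>M\<^esub> m)"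
    and twist_emb [simp]: "twist E (emb (a, m)) = emb (twist A a, btwist M m)"
    and prd_emb [simp]: "\<lbrakk>b \<in> carrier A; n \<in> carrier M\<rbrakk> \<Longrightarrow> prd E k (emb (a, m)) (emb (b, n)) =
      emb (prd A k a b, F k [a, b] \<oplus>\<^bsub>M\<^esub> lact M k a n \<oplus>\<^bsub>M\<^esub> ract M k m b)"
  using assms by (simp_all add: E_def[THEN arg_cong[of _ _ add]] E_def[THEN arg_cong[of _ _ smult]]
      E_def[THEN arg_cong[of _ _ twist]] E_def[THEN arg_cong[of _ _ prd]])

lemma zero_E [simp]: "\<zero>\<^bsub>E\<^esub> = emb (\<zero>\<^bsub>A\<^esub>, \<zero>\<^bsub>M\<^esub>)"
  by (simp add: E_def)

lemma vectorspace_E: "vectorspace K E"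
proof (rule vs_criteria, goal_cases)
  case 1
  show ?case by (rule A.V.field_axioms)
next
  case 4
  have "emb (a, m) \<oplus>\<^bsub>E\<^esub> emb (\<ominus>\<^bsub>A\<^esub> a, \<ominus>\<^bsub>M\<^esub> m) = \<zero>\<^bsub>E\<^esub>" if "a \<in> carrier A" "m \<in> carrier M" for a m
    using that by (simp add: A.V.M.r_neg M.M.r_neg)
  then show ?case
    unfolding ball_carrier by (meson A.V.M.a_inv_closed M.M.a_inv_closed emb_closed)
qed (auto elim!: carrier_cases simp: A.V.M.a_ac M.M.a_ac A.V.smult_assoc1 M.smult_assoc1
    A.V.smult_l_distr M.smult_l_distr A.V.smult_r_distr M.smult_r_distr)

lemma F_cochain: "F \<in> carrier (cochain_group 2)"
  using cocycle by (simp add: cocycle_def)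

lemma
  assumes k: "k \<in> {1, 2}" and "a \<in> carrier A" "b \<in> carrier A"
  shows F_closed [simp]: "F k [a, b] \<in> carrier M"
    and F_add_right: "c \<in> carrier A \<Longrightarrow> F k [a, b \<oplus>\<^bsub>A\<^esub> c] = F k [a, b] \<oplus>\<^bsub>M\<^esub> F k [a, c]"
    and F_smult_right: "c' \<in> carrier K \<Longrightarrow> F k [a, c' \<odot>\<^bsub>A\<^esub> b] = c' \<odot>\<^bsub>M\<^esub> F k [a, b]"
    and F_add_left: "c \<in> carrier A \<Longrightarrow> F k [a \<oplus>\<^bsub>A\<^esub> b, c] = F k [a, c] \<oplus>\<^bsub>M\<^esub> F k [b, c]"
    and F_smult_left: "c' \<in> carrier K \<Longrightarrow> F k [c' \<odot>\<^bsub>A\<^esub> a, b] = c' \<odot>\<^bsub>M\<^esub> F k [a, b]"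
    and F_twist: "btwist M (F k [a, b]) = F k [twist A a, twist A b]"
proof -
  have "F k \<in> cochains K A M 2"
    using F_cochain k unfolding carrier_cochain_group_2 by blast
  note F = this[unfolded cochains_2_iff bilinear_map_iff[OF A.V.vectorspace_axioms
        A.V.vectorspace_axioms M.vectorspace_axioms]]
  show "F k [a, b] \<in> carrier M"
    "c \<in> carrier A \<Longrightarrow> F k [a, b \<oplus>\<^bsub>A\<^esub> c] = F k [a, b] \<oplus>\<^bsub>M\<^esub> F k [a, c]"
    "c' \<in> carrier K \<Longrightarrow> F k [a, c' \<odot>\<^bsub>A\<^esub> b] = c' \<odot>\<^bsub>M\<^esub> F k [a, b]"
    "c \<in> carrier A \<Longrightarrow> F k [a \<oplus>\<^bsub>A\<^esub> b, c] = F k [a, c] \<oplus>\<^bsub>M\<^esub> F k [b, c]"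
    "c' \<in> carrier K \<Longrightarrow> F k [c' \<odot>\<^bsub>A\<^esub> a, b] = c' \<odot>\<^bsub>M\<^esub> F k [a, b]"
    "btwist M (F k [a, b]) = F k [twist A a, twist A b]"
    using F assms by blast+
qed

text \<open>
  Vanishing of \<open>F\<close> at zero arguments is what makes the actions induced by the extension, computed
  with the lifts \<open>(a, 0)\<close> and the elements \<open>(0, m)\<close>, the given ones.
\<close>

lemma F_zero [simp]:
  assumes "k \<in> {1, 2}" "a \<in> carrier A"
  shows "F k [a, \<zero>\<^bsub>A\<^esub>] = \<zero>\<^bsub>M\<^esub>" and "F k [\<zero>\<^bsub>A\<^esub>, a] = \<zero>\<^bsub>M\<^esub>"
  using assms F_add_right F_add_left
  by (intro A.V.additive_zero[of M "\<lambda>b. F k [a, b]"] A.V.additive_zero[of M "\<lambda>b. F k [b, a]"];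
      simp add: M.M.abelian_group_axioms)+

lemma bilinear_prd: "k \<in> {1, 2} \<Longrightarrow> bilinear_map K E E E (prd E k)"
  unfolding bilinear_map_iff[OF vectorspace_E vectorspace_E vectorspace_E]
  by (simp add: ball_carrier A.prd_add_right A.prd_add_left A.prd_smult_right
      A.prd_smult_left lact_add_right lact_add_left lact_smult_right lact_smult_left
      ract_add_right ract_add_left ract_smult_right ract_smult_left
      F_add_right F_add_left F_smult_right F_smult_left M.smult_r_distr M.M.a_ac)

lemma linear_twist: "linear_map K E E (twist E)"
  unfolding linear_map_iff[OF vectorspace_E vectorspace_E]
  by (simp add: ball_carrier A.twist_add A.twist_smult btwist_add btwist_smult)

lemma linear_sect: "linear_map K A E (\<lambda>a. emb (a, \<zero>\<^bsub>M\<^esub>))"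
  unfolding linear_map_iff[OF A.V.vectorspace_axioms vectorspace_E] by simp

lemma linear_incl: "linear_map K M E (\<lambda>m. emb (\<zero>\<^bsub>A\<^esub>, m))"
  unfolding linear_map_iff[OF M.vectorspace_axioms vectorspace_E] by simp

lemma linear_base: "linear_map K E A base"
  unfolding linear_map_iff[OF vectorspace_E A.V.vectorspace_axioms] by (simp add: ball_carrier)

lemma fin_dim_E: "vectorspace.fin_dim K E"
proof (rule fin_dim_sum_of_images[OF linear_sect linear_incl A.fin_dim fin_dim])
  fix e assume "e \<in> carrier E"
  then obtain a m where "a \<in> carrier A" "m \<in> carrier M" "e = emb (a, m)"
    by (rule carrier_cases)
  then show "\<exists>a\<in>carrier A. \<exists>m\<in>carrier M. e = emb (a, \<zero>\<^bsub>M\<^esub>) \<oplus>\<^bsub>E\<^esub> emb (\<zero>\<^bsub>A\<^esub>, m)"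
    by (intro bexI[of _ a] bexI[of _ m]) simp_all
qed

text \<open>
  Each bracketing of three elements splits into a part without elements of \<open>M\<close> other than values
  of \<open>F\<close>, and three terms that each carry one of \<open>m, n, p\<close>. The first part is governed by the cocycle
  condition, the three terms by the three axioms of a bimodule.
\<close>

lemma
  assumes "k \<in> {1, 2}" "l \<in> {1, 2}"
    and "a \<in> carrier A" "m \<in> carrier M" "b \<in> carrier A" "n \<in> carrier M" "c \<in> carrier A" "p \<in> carrier M"
  shows prd_left_emb: "prd E l (prd E k (emb (a, m)) (emb (b, n))) (twist E (emb (c, p))) =
      emb (prd A l (prd A k a b) (twist A c), assoc_left F k l a b c \<oplus>\<^bsub>M\<^esub>
        (lact M l (prd A k a b) (btwist M p) \<oplus>\<^bsub>M\<^esub> (ract M l (lact M k a n) (twist A c)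
         \<oplus>\<^bsub>M\<^esub> ract M l (ract M k m b) (twist A c))))"
    and prd_right_emb: "prd E k (twist E (emb (a, m))) (prd E l (emb (b, n)) (emb (c, p))) =
      emb (prd A k (twist A a) (prd A l b c), assoc_right F k l a b c \<oplus>\<^bsub>M\<^esub>
        (lact M k (twist A a) (lact M l b p) \<oplus>\<^bsub>M\<^esub> (lact M k (twist A a) (ract M l n c)
         \<oplus>\<^bsub>M\<^esub> ract M k (btwist M m) (prd A l b c))))"
  using assms by (simp_all add: assoc_left_def assoc_right_def lact_add_right ract_add_left M.M.a_ac)

lemma assoc_closed [simp]:
  assumes "k \<in> {1, 2}" "l \<in> {1, 2}" "a \<in> carrier A" "b \<in> carrier A" "c \<in> carrier A"
  shows "assoc_left F k l a b c \<in> carrier M" "assoc_right F k l a b c \<in> carrier M"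
  using assms by (simp_all add: assoc_left_def assoc_right_def)

lemma hom_assoc_algebra_E:
  assumes k: "k \<in> {1, 2}"
  shows "hom_assoc_algebra K E (prd E k) (twist E)"
proof (intro hom_assoc_algebra.intro hom_assoc_algebra_axioms.intro vectorspace_E fin_dim_E
    bilinear_prd linear_twist k)
  fix x y assume "x \<in> carrier E" "y \<in> carrier E"
  then show "twist E (prd E k x y) = prd E k (twist E x) (twist E y)"
    using k by (elim carrier_cases) (simp add: A.twist_prd btwist_add F_twist btwist_lact btwist_ract)
next
  fix x y z assume "x \<in> carrier E" "y \<in> carrier E" "z \<in> carrier E"
  then obtain a m b n c p where *: "a \<in> carrier A" "m \<in> carrier M" "b \<in> carrier A" "n \<in> carrier M"
      "c \<in> carrier A" "p \<in> carrier M" "x = emb (a, m)" "y = emb (b, n)" "z = emb (c, p)"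
    by (metis carrier_cases)
  have "assoc_left F k k a b c = assoc_right F k k a b c"
    using cocycle k * by (simp only: cocycle_def)
  then show "prd E k (prd E k x y) (twist E z) = prd E k (twist E x) (prd E k y z)"
    using k * by (simp only: prd_left_emb prd_right_emb A.prd_assoc lact_assoc lact_ract_assoc ract_assoc)
qed

lemma compatible_hom_assoc_algebra_E: "compatible_hom_assoc_algebra K E"
proof (intro compatible_hom_assoc_algebra.intro hom_assoc_algebra_E)
  fix x y z assume "x \<in> carrier E" "y \<in> carrier E" "z \<in> carrier E"
  then obtain a m b n c p where *: "a \<in> carrier A" "m \<in> carrier M" "b \<in> carrier A" "n \<in> carrier M"
      "c \<in> carrier A" "p \<in> carrier M" and xyz: "x = emb (a, m)" "y = emb (b, n)" "z = emb (c, p)"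
    by (metis carrier_cases)
  have 12: "1 \<in> {1, 2::nat}" "2 \<in> {1, 2::nat}" by simp_all
  note L = prd_left_emb[OF 12 *] prd_left_emb[OF 12(2,1) *]
  note R = prd_right_emb[OF 12 *] prd_right_emb[OF 12(2,1) *]
  have F: "assoc_left F 1 2 a b c \<oplus>\<^bsub>M\<^esub> assoc_left F 2 1 a b c
      = assoc_right F 1 2 a b c \<oplus>\<^bsub>M\<^esub> assoc_right F 2 1 a b c"
    using cocycle * by (simp only: cocycle_def)
  show "prd E 2 (prd E 1 x y) (twist E z) \<oplus>\<^bsub>E\<^esub> prd E 1 (prd E 2 x y) (twist E z)
      = prd E 1 (twist E x) (prd E 2 y z) \<oplus>\<^bsub>E\<^esub> prd E 2 (twist E x) (prd E 1 y z)"
    unfolding xyz L R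
    using * A.compatible[of a b c] compatible_l[of a b p] compatible_l_r[of a n c]
      compatible_r[of m b c] F
    by (simp add: M.M.sum_regroup)
qed

lemma vectorspace_trivial_comp_alg: "vectorspace K (trivial_comp_alg M)"
  by (rule vs_criteria) (auto simp: A.V.field_axioms M.M.a_ac M.smult_assoc1 M.smult_l_distr
      M.smult_r_distr intro: M.M.r_neg bexI[of _ "\<ominus>\<^bsub>M\<^esub> _"])

lemma X_simps [simp]:
  "total X = E" "incl X m = emb (\<zero>\<^bsub>A\<^esub>, m)" "proj X = base" "sect X a = emb (a, \<zero>\<^bsub>M\<^esub>)"
  by (simp_all add: X_def)

lemma abelian_extension_X: "abelian_extension K A M X"
proof (rule abelian_extension.intro)
  show "compatible_hom_assoc_algebra K (total X)"
    by (simp add: compatible_hom_assoc_algebra_E)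
  show "comp_alg_morphism K (trivial_comp_alg M) (total X) (incl X)"
    using linear_incl
    unfolding comp_alg_morphism_def linear_map_iff[OF M.vectorspace_axioms vectorspace_E]
    by (simp add: linear_map_iff[OF vectorspace_trivial_comp_alg vectorspace_E])
  show "comp_alg_morphism K (total X) A (proj X)"
    using linear_base by (simp add: comp_alg_morphism_def ball_carrier)
  show "inj_on (incl X) (carrier M)"
    by (auto simp: inj_on_def)
  show "incl X ` carrier M = {e \<in> carrier (total X). proj X e = \<zero>\<^bsub>A\<^esub>}"
    by (auto elim: carrier_cases)
  show "proj X ` carrier (total X) = carrier A"
  proof
    show "carrier A \<subseteq> proj X ` carrier (total X)"
    proof
      fix a assume "a \<in> carrier A"
      then show "a \<in> proj X ` carrier (total X)"
        by (intro image_eqI[of _ _ "emb (a, \<zero>\<^bsub>M\<^esub>)"]) simp_all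
    qed
  qed (auto elim: carrier_cases)
  show "linear_map K A (total X) (sect X)"
    using linear_sect by (simp add: X_def)
qed simp_all

lemma X_inducing: "X \<in> extensions_inducing K A M"
proof -
  have "inv_into (carrier M) (incl X) (emb (\<zero>\<^bsub>A\<^esub>, m)) = m" if "m \<in> carrier M" for m
    using that inv_into_f_f[of "incl X" "carrier M" m] by (simp add: inj_on_def)
  then have "induced_lact M X k a m = lact M k a m" "induced_ract M X k m a = ract M k m a"
    if "k \<in> {1, 2}" "a \<in> carrier A" "m \<in> carrier M" for k a m
    using that by (simp_all add: induced_lact_def induced_ract_def)
  then show ?thesis
    unfolding extensions_inducing_def using abelian_extension_X by blast
qed

text \<open>
  Multiplying the lifts \<open>(a, 0)\<close> and \<open>(b, 0)\<close> leaves \<open>F\<^sub>k(a, b)\<close> as \<open>M\<close>-coordinate.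
\<close>

lemma factor_set_X: "inducing_extension.factor_set A M X = F"
proof -
  interpret I: inducing_extension K A M X
    by unfold_locales (rule X_inducing)
  have "I.factor_set k [a, b] = F k [a, b]" if "k \<in> {1, 2}" "a \<in> carrier A" "b \<in> carrier A" for k a b
    using that by (simp add: I.factor_set) (rule I.fibre_eqI[of _ "prd A k a b"]; simp)
  then show ?thesis
    using cochain_group_eq_iff_2[OF I.factor_set_cochain F_cochain] by blast
qed

end


section \<open>Classification\<close>

text \<open>
  A function whose level sets are the classes of \<open>r\<close> induces a bijection between its image and the
  quotient. The premises force \<open>r\<close> to be an equivalence relation on \<open>S\<close>.
\<close>

lemma bij_betw_quotient:
  assumes "r \<subseteq> S \<times> S" and "\<And>x y. \<lbrakk>x \<in> S; y \<in> S\<rbrakk> \<Longrightarrow> (x, y) \<in> r \<longleftrightarrow> f x = f y"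
  shows "bij_betw (\<lambda>t. {y \<in> S. f y = t}) (f ` S) (S // r)"
proof (rule bij_betw_imageI)
  show "inj_on (\<lambda>t. {y \<in> S. f y = t}) (f ` S)"
    by (rule inj_onI) blast
  have "r `` {x} = {y \<in> S. f y = f x}" if "x \<in> S" for x
    using assms that by auto
  then show "(\<lambda>t. {y \<in> S. f y = t}) ` f ` S = S // r"
    by (auto simp: quotient_def)
qed

theorem theorem5p1:
  fixes K :: "('k, 'x) ring_scheme"
    and A :: "('k, 'a) comp_alg"
    and M :: "('k, 'a, 'm) comp_bimod"
    and emb :: "'a \<times> 'm \<Rightarrow> 'e"
  assumes "field K"
    and char_0: "\<And>n::nat. n > 0 \<Longrightarrow> [n] \<cdot>\<^bsub>K\<^esub> \<one>\<^bsub>K\<^esub> \<noteq> \<zero>\<^bsub>K\<^esub>"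
    and "compatible_hom_assoc_algebra K A"
    and "compatible_bimodule K A M"
    \<comment> \<open>the elements of total spaces are drawn from an arbitrary type \<open>'e\<close>, required only to be
        large enough to hold one vector space of the right dimension\<close>
    and "inj_on emb (carrier A \<times> carrier M)"
  shows "\<exists>\<Phi>. bij_betw \<Phi> (carrier (comp_cohomology K A M 2))
               (Ext_c K A M :: ('k, 'a, 'm, 'e) extension set set)"
proof -
  interpret compatible_bimodule K A M by fact
  let ?S = "extensions_inducing K A M :: ('k, 'a, 'm, 'e) extension set"
  let ?cls = "\<lambda>X :: ('k, 'a, 'm, 'e) extension. cohomology_class (inducing_extension.factor_set A M X)"
  have "?cls ` ?S = carrier (comp_cohomology K A M 2)"
  proof
    show "?cls ` ?S \<subseteq> carrier (comp_cohomology K A M 2)"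
    proof (rule image_subsetI)
      fix X assume "X \<in> ?S"
      then interpret X: inducing_extension K A M X by unfold_locales
      show "?cls X \<in> carrier (comp_cohomology K A M 2)"
        using X.factor_set_cocycle by (simp add: carrier_comp_cohomology_2)
    qed
    show "carrier (comp_cohomology K A M 2) \<subseteq> ?cls ` ?S"
    proof
      fix C assume "C \<in> carrier (comp_cohomology K A M 2)"
      then obtain F where F: "cocycle F" "C = cohomology_class F"
        by (auto simp: carrier_comp_cohomology_2)
      then interpret T: twisted_product K A M emb F
        using assms by unfold_locales
      show "C \<in> ?cls ` ?S"
        using F(2) T.X_inducing T.factor_set_X by (intro image_eqI[of _ _ T.X]) simp_all
    qed
  qed
  moreover have "bij_betw (\<lambda>C. {Y \<in> ?S. ?cls Y = C}) (?cls ` ?S) (?S // extension_equiv K A M)"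
    by (rule bij_betw_quotient) (auto simp: extension_equiv_iff, auto simp: extension_equiv_def)
  ultimately show ?thesis
    unfolding Ext_c_def by auto
qed

end
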